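(* Let $\mathbb{K}$ be a field, $R=\mathbb{K}[X_1,\dots,X_n]$ with its standard $\mathbb{Z}^n$-grading, and $M$ a finitely generated $\mathbb{Z}^n$-graded $R$-module that is positively $\mathbf{g}$-determined for some $\mathbf{g}\in\mathbb{N}^n$. Then there are only finitely many $\mathbf{g}$-determined Hilbert decompositions of $M$ (up to re-indexing), and $$\operatorname{sdepth}M=\max\{\operatorname{depth}\mathfrak{D} : \mathfrak{D}\text{ is a }\mathbf{g}\text{-determined Hilbert decomposition of }M\text{ which is induced by a Stanley decomposition of }M\}.$$
   Context: Notation: $[n]=\{1,\dots,n\}$; $\preceq$ is the componentwise order on $\mathbb{Z}^n$; $\mathbf{e}_k$ is the $k$-th unit vector; $\mathbb{N}$ contains $0$. Positively $\mathbf{g}$-determined: $M_{\mathbf{a}}=0$ for $\mathbf{a}\notin\mathbb{N}^n$, and multiplication by $X_k$, $M_{\mathbf{a}}\to M_{\mathbf{a}+\mathbf{e}_k}$, is an isomorphism whenever $a_k\ge g_k$. Hilbert decomposition of $M$: a finite family $(R_i,\mathbf{s}_i)_{i\in I}$ with $\mathbf{s}_i\in\mathbb{Z}^n$ and each $R_i=\mathbb{K}[X_j : j\in Z_i]$ ($Z_i\subseteq[n]$), such that $M\cong\bigoplus_{i\in I}R_i(-\mathbf{s}_i)$ as multigraded $\mathbb{K}$-vector spaces. For $M$ positively $\mathbf{g}$-determined, it is $\mathbf{g}$-determined if $\mathbf{s}_i\preceq\mathbf{g}$ for all $i$ (equivalently, $\{j : (\mathbf{s}_i)_j=g_j\}\subseteq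 Z_i$ for all $i$). Stanley decomposition of $M$: a finite family $(R_i,m_i)_{i\in I}$ with $m_i\in M$ homogeneous and each $R_i=\mathbb{K}[X_j : j\in Z_i]$ ($Z_i\subseteq[n]$), such that $R_i\cap\operatorname{Ann}m_i=0$ for each $i$ and $M=\bigoplus_{i\in I}m_iR_i$ as a multigraded $\mathbb{K}$-vector space. A Hilbert decomposition $(R_i,\mathbf{s}_i)_{i\in I}$ is induced by a Stanley decomposition if there is a Stanley decomposition $(R_i,m_i)_{i\in I}$ of $M$ with $\deg m_i=\mathbf{s}_i$ for all $i$. The depth of a Hilbert (or Stanley) decomposition is the minimal Krull dimension of the subalgebras $R_i$. The Stanley depth $\operatorname{sdepth}M$ is the maximal depth of a Stanley decomposition of $M$. *)

theory Defs
  imports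
    "HOL-Library.Poly_Mapping"
    "HOL-Library.Function_Algebras"
    "HOL-Library.Extended_Nat"
    "HOL-Library.Multiset"
    "HOL-Algebra.Ideal"
begin

text \<open>
  The polynomial ring over \<open>'k\<close> in the variables indexed by the finite type \<open>'n\<close> is the type of
  finitely supported functions from exponents to coefficients, with the convolution product.
  Multidegrees are functions \<open>'n \<Rightarrow> int\<close> with pointwise addition and order.
\<close>

type_synonym ('n, 'k) mpolys = "('n \<Rightarrow>\<^sub>0 nat) \<Rightarrow>\<^sub>0 'k"
type_synonym 'n mdeg = "'n \<Rightarrow> int"

definition const :: "'k \<Rightarrow> ('n, 'k::zero) mpolys"
  where "const c = Poly_Mapping.single 0 c"

definition var :: "'n \<Rightarrow> ('n, 'k::zero_neq_one) mpolys"
  where "var k = Poly_Mapping.single (Poly_Mapping.single k 1) 1"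

definition unit_deg :: "'n \<Rightarrow> 'n mdeg"
  where "unit_deg k = (\<lambda>j. if j = k then 1 else 0)"

definition homogeneous_polys :: "'n mdeg \<Rightarrow> ('n, 'k::zero) mpolys set"
  where "homogeneous_polys a =
    {p. \<forall>t \<in> Poly_Mapping.keys p. \<forall>j. int (Poly_Mapping.lookup t j) = a j}"

definition polys_in :: "'n set \<Rightarrow> ('n, 'k::zero) mpolys set"
  where "polys_in Z = {p. \<forall>t \<in> Poly_Mapping.keys p. Poly_Mapping.keys t \<subseteq> Z}"

definition is_direct_sum :: "('i \<Rightarrow> 'm::ab_group_add set) \<Rightarrow> 'i set \<Rightarrow> bool"
  where "is_direct_sum N I \<longleftrightarrow>
    (\<forall>x. \<exists>!f :: 'i \<Rightarrow>\<^sub>0 'm. Poly_Mapping.keys f \<subseteq> I \<and>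
       (\<forall>i \<in> I. Poly_Mapping.lookup f i \<in> N i) \<and>
       x = (\<Sum>i \<in> Poly_Mapping.keys f. Poly_Mapping.lookup f i))"

locale multigraded_module = module scale
  for scale :: "('n::finite, 'k::field) mpolys \<Rightarrow> 'm::ab_group_add \<Rightarrow> 'm" +
  fixes G :: "'n mdeg \<Rightarrow> 'm set"
  assumes zero_in_grade: "0 \<in> G a"
    and add_in_grade: "x \<in> G a \<Longrightarrow> y \<in> G a \<Longrightarrow> x + y \<in> G a"
    and scale_in_grade: "p \<in> homogeneous_polys b \<Longrightarrow> x \<in> G a \<Longrightarrow> scale p x \<in> G (a + b)"
    and grades_direct_sum: "is_direct_sum G UNIV"

definition finitely_generated :: "('r::comm_ring_1 \<Rightarrow> 'm::ab_group_add \<Rightarrow> 'm) \<Rightarrow> bool"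
  where "finitely_generated scale \<longleftrightarrow> (\<exists>S. finite S \<and> module.span scale S = UNIV)"

definition positively_determined ::
  "(('n, 'k::field) mpolys \<Rightarrow> 'm::ab_group_add \<Rightarrow> 'm) \<Rightarrow> ('n mdeg \<Rightarrow> 'm set) \<Rightarrow> ('n \<Rightarrow> nat) \<Rightarrow> bool"
  where "positively_determined scale G g \<longleftrightarrow>
    (\<forall>a. \<not> (\<forall>k. 0 \<le> a k) \<longrightarrow> G a = {0}) \<and>
    (\<forall>a k. int (g k) \<le> a k \<longrightarrow> bij_betw (scale (var k)) (G a) (G (a + unit_deg k)))"

text \<open>
  A finite family indexed by \<open>I\<close> is a list, that is, a family with index set \<open>{..<length D}\<close>; two
  lists agree up to re-indexing iff they have the same multiset of entries. The first component of
  an entry is the subalgebra itself, not its set of variables.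

  The external direct sum of the shifted algebras \<open>R\<^sub>i(-s\<^sub>i)\<close> is realised by sequences of polynomials
  that vanish from position \<open>length D\<close> on. Its part of degree \<open>a\<close> uses \<open>R(-s)\<^sub>a = R\<^bsub>a - s\<^esub>\<close>.
\<close>

definition shifted_sum ::
  "(('n, 'k::zero) mpolys set \<times> 'n mdeg) list \<Rightarrow> (nat \<Rightarrow> ('n, 'k) mpolys) set"
  where "shifted_sum D =
    {f. (\<forall>i < length D. f i \<in> fst (D ! i)) \<and> (\<forall>i \<ge> length D. f i = 0)}"

definition shifted_sum_grade ::
  "(('n, 'k::zero) mpolys set \<times> 'n mdeg) list \<Rightarrow> 'n mdeg \<Rightarrow> (nat \<Rightarrow> ('n, 'k) mpolys) set"
  where "shifted_sum_grade D a =
    {f \<in> shifted_sum D. \<forall>i < length D. f i \<in> homogeneous_polys (a - snd (D ! i))}"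

definition hilbert_decomposition ::
  "(('n, 'k::field) mpolys \<Rightarrow> 'm::ab_group_add \<Rightarrow> 'm) \<Rightarrow> ('n mdeg \<Rightarrow> 'm set) \<Rightarrow>
   (('n, 'k) mpolys set \<times> 'n mdeg) list \<Rightarrow> bool"
  where "hilbert_decomposition scale G D \<longleftrightarrow>
    (\<forall>(A, s) \<in> set D. \<exists>Z. A = polys_in Z) \<and>
    (\<exists>\<phi> :: 'm \<Rightarrow> nat \<Rightarrow> ('n, 'k) mpolys.
       Vector_Spaces.linear (\<lambda>c. scale (const c)) (\<lambda>c f i. const c * f i) \<phi> \<and>
       bij_betw \<phi> UNIV (shifted_sum D) \<and>
       (\<forall>a. \<phi> ` G a = shifted_sum_grade D a))"

definition determined_hilbert_decomposition ::
  "(('n, 'k::field) mpolys \<Rightarrow> 'm::ab_group_add \<Rightarrow> 'm) \<Rightarrow> ('n mdeg \<Rightarrow> 'm set) \<Rightarrow> ('n \<Rightarrow> nat) \<Rightarrow>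
   (('n, 'k) mpolys set \<times> 'n mdeg) list \<Rightarrow> bool"
  where "determined_hilbert_decomposition scale G g D \<longleftrightarrow>
    hilbert_decomposition scale G D \<and> (\<forall>(A, s) \<in> set D. s \<le> (\<lambda>k. int (g k)))"

definition stanley_decomposition ::
  "(('n, 'k::field) mpolys \<Rightarrow> 'm::ab_group_add \<Rightarrow> 'm) \<Rightarrow> ('n mdeg \<Rightarrow> 'm set) \<Rightarrow>
   (('n, 'k) mpolys set \<times> 'm) list \<Rightarrow> bool"
  where "stanley_decomposition scale G D \<longleftrightarrow>
    (\<forall>(A, m) \<in> set D. (\<exists>Z. A = polys_in Z) \<and> (\<exists>a. m \<in> G a) \<and> A \<inter> {r. scale r m = 0} = {0}) \<and>
    is_direct_sum (\<lambda>i. (\<lambda>r. scale r (snd (D ! i))) ` fst (D ! i)) {..<length D}"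

text \<open>
  The elements \<open>m\<close> of a Stanley decomposition are nonzero because of the annihilator condition, so
  \<open>m \<in> G s\<close> says precisely that \<open>m\<close> has degree \<open>s\<close>.
\<close>

definition induced_by_stanley ::
  "(('n, 'k::field) mpolys \<Rightarrow> 'm::ab_group_add \<Rightarrow> 'm) \<Rightarrow> ('n mdeg \<Rightarrow> 'm set) \<Rightarrow>
   (('n, 'k) mpolys set \<times> 'n mdeg) list \<Rightarrow> bool"
  where "induced_by_stanley scale G D \<longleftrightarrow>
    (\<exists>E. stanley_decomposition scale G E \<and>
       list_all2 (\<lambda>(A, s) (B, m). A = B \<and> m \<in> G s) D E)"

definition subring_of :: "'r::comm_ring_1 set \<Rightarrow> 'r ring"
  where "subring_of A = \<lparr>carrier = A, mult = (*), one = 1, zero = 0, add = (+)\<rparr>"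

definition krull_dim :: "('a, 'b) ring_scheme \<Rightarrow> enat"
  where "krull_dim R = Sup {enat l | l. \<exists>P :: nat \<Rightarrow> 'a set.
    (\<forall>i \<le> l. primeideal (P i) R) \<and> (\<forall>i < l. P i \<subset> P (Suc i))}"

text \<open>
  The zero module has only the empty decomposition; its depth is the minimum of the empty family,
  that is \<open>\<infinity>\<close>.
\<close>

definition decomposition_depth :: "(('n, 'k::field) mpolys set \<times> 'x) list \<Rightarrow> enat"
  where "decomposition_depth D = (INF (A, x) \<in> set D. krull_dim (subring_of A))"

definition sdepth ::
  "(('n, 'k::field) mpolys \<Rightarrow> 'm::ab_group_add \<Rightarrow> 'm) \<Rightarrow> ('n mdeg \<Rightarrow> 'm set) \<Rightarrow> enat"
  where "sdepth scale G = Sup {decomposition_depth D | D. stanley_decomposition scale G D}"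

end

theory Submission
  imports Defs "HOL-Algebra.QuotRing"
begin

text \<open>
  A family \<open>(K[Z\<^sub>i], m\<^sub>i)\<close> with \<open>deg m\<^sub>i = s\<^sub>i\<close> is a Stanley decomposition iff, in each degree \<open>a\<close>, the
  elements \<open>X\<^bsup>a - s\<^sub>i\<^esup> m\<^sub>i\<close> with \<open>a \<in> s\<^sub>i + \<nat>\<^bsup>Z\<^sub>i\<^esup>\<close> form a basis of \<open>M\<^sub>a\<close>. Since \<open>M\<^sub>b \<cong> M\<^sub>a\<close> for \<open>b = min a g\<close>,
  this only has to be checked for \<open>0 \<le> a \<le> g\<close> once all \<open>s\<^sub>i \<le> g\<close> and \<open>{j. s\<^sub>i\<^sub>j = g\<^sub>j} \<subseteq> Z\<^sub>i\<close>. Given any Stanley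
  decomposition, drop the summands with \<open>\<not> s\<^sub>i \<le> g\<close> and replace \<open>Z\<^sub>i\<close> by \<open>Z\<^sub>i \<union> {j. s\<^sub>i\<^sub>j = g\<^sub>j}\<close>: in degrees
  below \<open>g\<close> nothing changes, so this is a \<open>g\<close>-determined decomposition, and its depth is not
  smaller.
\<close>

section \<open>Polynomials and their homogeneous parts\<close>

text \<open>Exponents are read as integer vectors so that differences of degrees, such as
  \<open>a - s i\<close>, are exact; subtraction of \<open>nat\<close> exponents would
  truncate.\<close>

definition tdeg :: "('n \<Rightarrow>\<^sub>0 nat) \<Rightarrow> 'n mdeg"
  where "tdeg t = (\<lambda>j. int (Poly_Mapping.lookup t j))"

lemma tdeg_add: "tdeg (s + t) = tdeg s + tdeg t"
  by (auto simp: tdeg_def lookup_add)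

lemma tdeg_zero: "tdeg 0 = 0"
  by (simp add: tdeg_def zero_fun_def)

lemma inj_tdeg: "inj tdeg"
  by (rule injI) (auto simp: tdeg_def fun_eq_iff intro: poly_mapping_eqI)

lemma tdeg_eq_iff [simp]: "tdeg s = tdeg t \<longleftrightarrow> s = t"
  using inj_tdeg by (auto dest: injD)

lemma tdeg_nonneg: "0 \<le> tdeg t j"
  by (simp add: tdeg_def)

text \<open>As \<open>'n\<close> is finite, every function on it has finite support, so
  nonnegativity is the only obstruction to being an exponent.\<close>

lemma ex_tdeg:
  fixes a :: "'n::finite mdeg"
  assumes "\<And>j. 0 \<le> a j"
  obtains t where "tdeg t = a"
proof
  show "tdeg (Abs_poly_mapping (\<lambda>j. nat (a j))) = a"
    using assms by (auto simp: tdeg_def)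
qed

lemma homogeneous_polys_iff: "p \<in> homogeneous_polys a \<longleftrightarrow> (\<forall>t \<in> Poly_Mapping.keys p. tdeg t = a)"
  by (auto simp: homogeneous_polys_def tdeg_def fun_eq_iff)

lemma zero_in_homogeneous_polys [simp]: "0 \<in> homogeneous_polys a"
  by (simp add: homogeneous_polys_iff)

lemma zero_in_polys_in [simp]: "0 \<in> polys_in Z"
  by (simp add: polys_in_def)

lemma add_in_polys_in:
  "p \<in> polys_in Z \<Longrightarrow> q \<in> polys_in Z \<Longrightarrow> p + q \<in> polys_in Z"
  using keys_add[of p q] by (auto simp: polys_in_def)

lemma minus_in_polys_in:
  fixes p :: "('n, 'k::ab_group_add) mpolys"
  shows "p \<in> polys_in Z \<Longrightarrow> - p \<in> polys_in Z"
  by (auto simp: polys_in_def in_keys_iff)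

lemma diff_in_polys_in:
  fixes p :: "('n, 'k::ab_group_add) mpolys"
  shows "p \<in> polys_in Z \<Longrightarrow> q \<in> polys_in Z \<Longrightarrow> p - q \<in> polys_in Z"
  using add_in_polys_in[OF _ minus_in_polys_in, of p Z q] by simp

lemma sum_in_polys_in:
  "(\<And>i. i \<in> I \<Longrightarrow> f i \<in> polys_in Z) \<Longrightarrow> sum f I \<in> polys_in Z"
  by (induction I rule: infinite_finite_induct) (auto intro: add_in_polys_in)

lemma keys_plus_nat:
  fixes s t :: "'n \<Rightarrow>\<^sub>0 nat"
  shows "Poly_Mapping.keys (s + t) = Poly_Mapping.keys s \<union> Poly_Mapping.keys t"
  by (auto simp: in_keys_iff lookup_add)

lemma mult_in_polys_in:
  "p \<in> polys_in Z \<Longrightarrow> q \<in> polys_in Z \<Longrightarrow> p * q \<in> polys_in Z"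
  using keys_mult[of p q] by (fastforce simp: polys_in_def keys_plus_nat)

lemma mult_in_homogeneous_polys:
  "p \<in> homogeneous_polys a \<Longrightarrow> q \<in> homogeneous_polys b \<Longrightarrow> p * q \<in> homogeneous_polys (a + b)"
  using keys_mult[of p q] by (fastforce simp: homogeneous_polys_iff tdeg_add)

lemma one_in_polys_in: "1 \<in> polys_in Z"
  by (auto simp: polys_in_def)

lemma const_in_polys_in: "const c \<in> polys_in Z"
  by (auto simp: polys_in_def const_def)

lemma const_in_homogeneous_polys: "const c \<in> homogeneous_polys 0"
  by (auto simp: homogeneous_polys_iff const_def tdeg_def)

lemma one_in_homogeneous_polys: "1 \<in> homogeneous_polys 0"
  by (auto simp: homogeneous_polys_iff tdeg_def)

lemma const_mult_distrib:
  "const 1 = 1" "const (a + b) = const a + const b" "const (a * b) = const a * const b"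
  by (simp_all add: const_def single_add mult_single)

lemma single_in_homogeneous_polys: "Poly_Mapping.single t c \<in> homogeneous_polys (tdeg t)"
  by (auto simp: homogeneous_polys_iff)

text \<open>The grading is fine: \<open>tdeg\<close> is injective, so each degree contains at most
  one monomial. Most later arguments on homogeneous polynomials thereby become arguments about one
  exponent.\<close>

lemma homogeneous_polys_cases:
  assumes "p \<in> homogeneous_polys a"
  obtains "p = 0" | t c where "tdeg t = a" "c \<noteq> 0" "p = Poly_Mapping.single t c"
proof (cases "p = 0")
  case False
  then obtain t where t: "t \<in> Poly_Mapping.keys p"
    by (metis poly_mapping_eqI in_keys_iff lookup_zero)
  then have "p = Poly_Mapping.single t (Poly_Mapping.lookup p t)"
    using assms by (intro poly_mapping_eqI)
      (metis homogeneous_polys_iff in_keys_iff lookup_single_eq lookup_single_not_eq tdeg_eq_iff)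
  then show thesis using that t assms by (metis homogeneous_polys_iff in_keys_iff)
qed

section \<open>Truncation of polynomials to a set of exponents\<close>

lift_definition restrict_keys :: "'a set \<Rightarrow> ('a \<Rightarrow>\<^sub>0 'b::zero) \<Rightarrow> 'a \<Rightarrow>\<^sub>0 'b"
  is "\<lambda>S f x. if x \<in> S then f x else 0"
  by (auto elim: finite_subset[rotated])

lemma keys_restrict_keys: "Poly_Mapping.keys (restrict_keys S p) = Poly_Mapping.keys p \<inter> S"
  by transfer auto

lemma restrict_keys_add: "restrict_keys S (p + q) = restrict_keys S p + restrict_keys S q"
  by transfer auto

lemma restrict_keys_zero [simp]: "restrict_keys S 0 = 0"
  by transfer auto

lemma restrict_keys_single:
  "restrict_keys S (Poly_Mapping.single t c) = (if t \<in> S then Poly_Mapping.single t c else 0)"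
  by transfer (auto simp: when_def)

lemma restrict_keys_id: "Poly_Mapping.keys p \<subseteq> S \<Longrightarrow> restrict_keys S p = p"
  by (rule poly_mapping_eqI) (auto simp: restrict_keys.rep_eq in_keys_iff subset_iff)

lemma restrict_keys_eq_zero: "Poly_Mapping.keys p \<inter> S = {} \<Longrightarrow> restrict_keys S p = 0"
  by (rule poly_mapping_eqI) (auto simp: restrict_keys.rep_eq in_keys_iff)

lemma restrict_keys_compl: "restrict_keys S p + restrict_keys (- S) p = p"
  for p :: "'a \<Rightarrow>\<^sub>0 'b::monoid_add"
  by transfer auto

abbreviation hpart :: "'n mdeg \<Rightarrow> ('n, 'k::zero) mpolys \<Rightarrow> ('n, 'k) mpolys"
  where "hpart a \<equiv> restrict_keys {t. tdeg t = a}"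

lemma hpart_homogeneous: "hpart a p \<in> homogeneous_polys a"
  by (auto simp: homogeneous_polys_iff keys_restrict_keys)

lemma hpart_polys_in: "p \<in> polys_in Z \<Longrightarrow> hpart a p \<in> polys_in Z"
  by (auto simp: polys_in_def keys_restrict_keys)

lemma hpart_eqI: "(\<And>a. hpart a p = hpart a q) \<Longrightarrow> p = q"
proof (rule poly_mapping_eqI)
  fix t assume eq: "\<And>a. hpart a p = hpart a q"
  have "Poly_Mapping.lookup (hpart (tdeg t) p) t = Poly_Mapping.lookup (hpart (tdeg t) q) t"
    by (simp only: eq)
  then show "Poly_Mapping.lookup p t = Poly_Mapping.lookup q t"
    by (simp add: restrict_keys.rep_eq del: tdeg_eq_iff)
qed

lemma poly_mapping_expand: "p = (\<Sum>t \<in> Poly_Mapping.keys p. Poly_Mapping.single t (Poly_Mapping.lookup p t))"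
proof (rule poly_mapping_eqI)
  fix u
  have "(\<Sum>t \<in> Poly_Mapping.keys p. Poly_Mapping.lookup (Poly_Mapping.single t (Poly_Mapping.lookup p t)) u)
      = (\<Sum>t \<in> Poly_Mapping.keys p. if t = u then Poly_Mapping.lookup p u else 0)"
    by (intro sum.cong) (auto simp: lookup_single)
  then show "Poly_Mapping.lookup p u = Poly_Mapping.lookup
      (\<Sum>t \<in> Poly_Mapping.keys p. Poly_Mapping.single t (Poly_Mapping.lookup p t)) u"
    by (simp add: lookup_sum in_keys_iff)
qed

section \<open>Finite families and external direct sums of polynomial subalgebras\<close>

lemma sum_lookup_keys:
  assumes "finite F" "Poly_Mapping.keys f \<subseteq> F"
  shows "(\<Sum>i \<in> Poly_Mapping.keys f. Poly_Mapping.lookup f i) = (\<Sum>i \<in> F. Poly_Mapping.lookup f i)"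
  using assms by (intro sum.mono_neutral_left) (auto simp: in_keys_iff)

text \<open>\<open>is_direct_sum\<close> speaks of finitely supported functions; this packs a family
  over a finite set into such a function without changing its sum.\<close>

lemma ex_poly_mapping_sum:
  assumes "finite F"
  obtains f where "Poly_Mapping.lookup f = (\<lambda>i. if i \<in> F then y i else 0)"
    "Poly_Mapping.keys f \<subseteq> F" "(\<Sum>i \<in> Poly_Mapping.keys f. Poly_Mapping.lookup f i) = sum y F"
proof -
  define f where "f = Abs_poly_mapping (\<lambda>i. if i \<in> F then y i else 0)"
  have lookup: "Poly_Mapping.lookup f = (\<lambda>i. if i \<in> F then y i else 0)"
    unfolding f_def using assms by (intro lookup_Abs_poly_mapping) (auto elim: finite_subset[rotated])
  then have keys: "Poly_Mapping.keys f \<subseteq> F"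
    by (auto simp: in_keys_iff split: if_splits)
  have "(\<Sum>i \<in> Poly_Mapping.keys f. Poly_Mapping.lookup f i) = sum y F"
    by (subst sum_lookup_keys[OF assms keys]) (simp add: lookup)
  then show thesis using that lookup keys by blast
qed

definition polys_fam :: "'i set \<Rightarrow> ('i \<Rightarrow> 'n set) \<Rightarrow> ('i \<Rightarrow> ('n, 'k::zero) mpolys) set"
  where "polys_fam I Z = {f. (\<forall>i \<in> I. f i \<in> polys_in (Z i)) \<and> (\<forall>i. i \<notin> I \<longrightarrow> f i = 0)}"

definition fam_grade ::
  "'i set \<Rightarrow> ('i \<Rightarrow> 'n set) \<Rightarrow> ('i \<Rightarrow> 'n mdeg) \<Rightarrow> 'n mdeg \<Rightarrow> ('i \<Rightarrow> ('n, 'k::zero) mpolys) set"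
  where "fam_grade I Z s a = {f \<in> polys_fam I Z. \<forall>i \<in> I. f i \<in> homogeneous_polys (a - s i)}"

lemma polys_famD:
  "f \<in> polys_fam I Z \<Longrightarrow> i \<in> I \<Longrightarrow> f i \<in> polys_in (Z i)"
  "f \<in> polys_fam I Z \<Longrightarrow> i \<notin> I \<Longrightarrow> f i = 0"
  by (simp_all add: polys_fam_def)

lemma fam_grade_outside: "f \<in> fam_grade I Z s a \<Longrightarrow> i \<notin> I \<Longrightarrow> f i = 0"
  by (simp add: fam_grade_def polys_fam_def)

lemma shifted_sum_map:
  "shifted_sum (map (\<lambda>i. (polys_in (Z i), s i)) [0..<n]) = polys_fam {..<n} Z"
  by (auto simp: shifted_sum_def polys_fam_def)

lemma shifted_sum_grade_map:
  "shifted_sum_grade (map (\<lambda>i. (polys_in (Z i), s i)) [0..<n]) a = fam_grade {..<n} Z s a"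
  by (auto simp: shifted_sum_grade_def shifted_sum_map fam_grade_def)

text \<open>Needed to return from an arbitrary finite index set to the positions of a list.\<close>

lemma bij_betw_reindex_polys_fam:
  fixes h :: "'j \<Rightarrow> 'i" and Z :: "'i \<Rightarrow> 'n set"
  assumes "bij_betw h J I"
  shows "bij_betw (\<lambda>f j. if j \<in> J then f (h j) else 0)
    (polys_fam I Z :: ('i \<Rightarrow> ('n, 'k::zero) mpolys) set) (polys_fam J (Z \<circ> h))"
proof (rule bij_betw_byWitness)
  let ?T = "\<lambda>(f :: 'i \<Rightarrow> ('n, 'k) mpolys) j. if j \<in> J then f (h j) else 0"
  let ?U = "\<lambda>(f :: 'j \<Rightarrow> ('n, 'k) mpolys) i. if i \<in> I then f (inv_into J h i) else 0"
  have inv: "inv_into J h i \<in> J" "h (inv_into J h i) = i" if "i \<in> I" for i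
    using assms that by (auto simp: bij_betw_def inv_into_into f_inv_into_f)
  have h: "h j \<in> I" "inv_into J h (h j) = j" if "j \<in> J" for j
    using assms that by (auto simp: bij_betw_def)
  show "\<forall>f \<in> polys_fam I Z. ?U (?T f) = f"
    by (auto simp: polys_fam_def inv)
  show "\<forall>f \<in> polys_fam J (Z \<circ> h). ?T (?U f) = f"
    by (auto simp: polys_fam_def h)
  show "?T ` polys_fam I Z \<subseteq> polys_fam J (Z \<circ> h)"
    by (auto simp: polys_fam_def h)
  show "?U ` polys_fam J (Z \<circ> h) \<subseteq> polys_fam I Z"
    using inv by (fastforce simp: polys_fam_def)
qed

lemma vector_space_fun:
  "vector_space (\<lambda>(c :: 'k::field) (f :: 'i \<Rightarrow> ('n, 'k) mpolys) i. const c * f i)"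
  by unfold_locales (auto simp: const_mult_distrib algebra_simps)

lemma sum_fun_apply: "(\<Sum>a \<in> A. f a) x = (\<Sum>a \<in> A. f a x)"
  by (induction A rule: infinite_finite_induct) simp_all

lemma is_direct_sum_cong:
  "(\<And>i. i \<in> I \<Longrightarrow> N i = N' i) \<Longrightarrow> is_direct_sum N I \<longleftrightarrow> is_direct_sum N' I"
  by (simp add: is_direct_sum_def)

lemma ex1_unique: "\<exists>!x. P x \<Longrightarrow> P x \<Longrightarrow> P y \<Longrightarrow> x = y"
  by blast

section \<open>Degrees between 0 and g, and shifts by monomials\<close>

definition degree_box :: "('n \<Rightarrow> nat) \<Rightarrow> 'n mdeg set"
  where "degree_box g = {s. \<forall>j. 0 \<le> s j \<and> s j \<le> int (g j)}"

lemma finite_degree_box: "finite (degree_box (g :: 'n::finite \<Rightarrow> nat))"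
proof (rule finite_subset)
  show "degree_box g \<subseteq> Pi\<^sub>E UNIV (\<lambda>j. {0..int (g j)})"
    by (auto simp: degree_box_def)
qed (intro finite_PiE; simp)

lemma finite_tdeg_fiber: "finite {t. tdeg t = a}"
  using finite_vimageI[OF _ inj_tdeg, of "{a}"] by (simp add: vimage_def)

text \<open>Multiplication by X^t only moves coefficients: the one at \<open>t + u\<close> in the
  product is the one at \<open>u\<close> in the factor.\<close>

lemma single_mult_cancel:
  fixes p q :: "('n, 'k::comm_semiring_1) mpolys"
  assumes "Poly_Mapping.single t 1 * p = Poly_Mapping.single t 1 * q"
  shows "p = q"
proof (rule poly_mapping_eqI)
  fix u
  have "Poly_Mapping.lookup (Poly_Mapping.single t 1 * p) (t + u) = Poly_Mapping.lookup p u"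
    for p :: "('n, 'k) mpolys"
  proof -
    have "Poly_Mapping.lookup (Poly_Mapping.single t 1 * p) (t + u) = (\<Sum>v \<in> Poly_Mapping.keys p.
        Poly_Mapping.lookup (Poly_Mapping.single (t + v) (Poly_Mapping.lookup p v)) (t + u))"
      by (subst poly_mapping_expand[of p]) (simp add: sum_distrib_left mult_single lookup_sum)
    also have "\<dots> = (\<Sum>v \<in> Poly_Mapping.keys p. if v = u then Poly_Mapping.lookup p u else 0)"
      by (intro sum.cong) (auto simp: lookup_single when_def)
    finally show ?thesis
      by (simp add: in_keys_iff)
  qed
  with assms show "Poly_Mapping.lookup p u = Poly_Mapping.lookup q u"
    by metis
qed

text \<open>The polynomial counterpart of M_b and M_a being isomorphic for b = min a g. In each
  summand X^t has to stay inside K[Z_i] when it multiplies something nonzero, and has to divide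
  everything of degree a.\<close>

lemma single_mult_fam_grade:
  fixes I :: "'i set" and Z :: "'i \<Rightarrow> 'n::finite set"
  assumes s: "\<And>i. i \<in> I \<Longrightarrow> s i \<in> degree_box g"
    and Z: "\<And>i j. i \<in> I \<Longrightarrow> s i j = int (g j) \<Longrightarrow> j \<in> Z i"
    and b: "b = (\<lambda>j. min (a j) (int (g j)))" and t: "tdeg t = a - b"
  shows "bij_betw (\<lambda>f i. Poly_Mapping.single t (1 :: 'k::field) * f i)
    (fam_grade I Z s b) (fam_grade I Z s a)"
proof (rule bij_betw_imageI)
  let ?x = "Poly_Mapping.single t (1 :: 'k)"
  show "inj_on (\<lambda>f i. ?x * f i) (fam_grade I Z s b)"
  proof (rule inj_onI)
    fix f h :: "'i \<Rightarrow> ('n, 'k) mpolys"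
    assume eq: "(\<lambda>i. ?x * f i) = (\<lambda>i. ?x * h i)"
    show "f = h"
    proof
      fix i
      show "f i = h i"
        using fun_cong[OF eq, of i] by (rule single_mult_cancel)
    qed
  qed
  show "(\<lambda>f i. ?x * f i) ` fam_grade I Z s b = fam_grade I Z s a"
  proof (intro equalityI subsetI)
    fix h :: "'i \<Rightarrow> ('n, 'k) mpolys" assume "h \<in> (\<lambda>f i. ?x * f i) ` fam_grade I Z s b"
    then obtain f where f: "f \<in> fam_grade I Z s b" and h: "h = (\<lambda>i. ?x * f i)"
      by blast
    have "?x * f i \<in> polys_in (Z i)" "?x * f i \<in> homogeneous_polys (a - s i)" if i: "i \<in> I" for i
    proof -
      have "f i \<in> homogeneous_polys (b - s i)" "f i \<in> polys_in (Z i)"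
        using f i by (simp_all add: fam_grade_def polys_fam_def)
      then show "?x * f i \<in> polys_in (Z i)"
      proof (elim homogeneous_polys_cases)
        fix u c assume u: "tdeg u = b - s i" "c \<noteq> 0" "f i = Poly_Mapping.single u c" "f i \<in> polys_in (Z i)"
        \<comment> \<open>If j were not in Z_i, then \<open>u\<close> would vanish at j, giving b_j
          = s_ij. As s_ij differs from g_j, this makes b_j = a_j, so X_j does not divide
          X^t.\<close>
        have "j \<in> Z i" if j: "j \<in> Poly_Mapping.keys t" for j
        proof (rule ccontr)
          assume "j \<notin> Z i"
          then have "Poly_Mapping.lookup u j = 0"
            using u by (auto simp: polys_in_def in_keys_iff)
          then have "b j = s i j"
            using fun_cong[OF u(1), of j] by (simp add: tdeg_def)
          moreover have "s i j \<noteq> int (g j)"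
            using Z i \<open>j \<notin> Z i\<close> by blast
          ultimately have "b j = a j"
            by (auto simp: b min_def split: if_splits)
          then show False
            using fun_cong[OF t, of j] j by (simp add: tdeg_def in_keys_iff)
        qed
        then show ?thesis
          using u by (auto simp: mult_single polys_in_def keys_plus_nat)
      qed simp
      have "?x * f i \<in> homogeneous_polys (tdeg t + (b - s i))"
        using f i by (intro mult_in_homogeneous_polys single_in_homogeneous_polys)
          (simp add: fam_grade_def)
      then show "?x * f i \<in> homogeneous_polys (a - s i)"
        by (simp add: t)
    qed
    then show "h \<in> fam_grade I Z s a"
      using f by (auto simp: h fam_grade_def polys_fam_def)
  next
    fix h :: "'i \<Rightarrow> ('n, 'k) mpolys" assume h: "h \<in> fam_grade I Z s a"
    have "\<exists>p. p \<in> polys_in (Z i) \<and> p \<in> homogeneous_polys (b - s i) \<and> ?x * p = h i" if i: "i \<in> I" for i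
    proof -
      have "h i \<in> homogeneous_polys (a - s i)" "h i \<in> polys_in (Z i)"
        using h i by (simp_all add: fam_grade_def polys_fam_def)
      then show ?thesis
      proof (elim homogeneous_polys_cases)
        fix u c assume u: "tdeg u = a - s i" "c \<noteq> 0" "h i = Poly_Mapping.single u c" "h i \<in> polys_in (Z i)"
        \<comment> \<open>\<open>s i\<close> is below \<open>a\<close> because \<open>u\<close> is
          an exponent, and below \<open>g\<close> because it lies in the box; hence it is below
          their minimum \<open>b\<close>.\<close>
        have "0 \<le> (b - s i) j" for j
          using s[OF i] tdeg_nonneg[of u j] by (auto simp: u(1) b degree_box_def)
        then obtain v where v: "tdeg v = b - s i"
          using ex_tdeg by blast
        have "tdeg (t + v) = tdeg u"
          unfolding tdeg_add t v u(1) by simp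
        then have "u = t + v" by simp
        then show ?thesis
          using u v by (intro exI[of _ "Poly_Mapping.single v c"])
            (auto simp: mult_single homogeneous_polys_iff polys_in_def keys_plus_nat)
      qed (intro exI[of _ 0], simp)
    qed
    then obtain p where p: "\<And>i. i \<in> I \<Longrightarrow>
        p i \<in> polys_in (Z i) \<and> p i \<in> homogeneous_polys (b - s i) \<and> ?x * p i = h i"
      by metis
    let ?f = "\<lambda>i. if i \<in> I then p i else 0"
    have "?f \<in> fam_grade I Z s b"
      using p by (auto simp: fam_grade_def polys_fam_def)
    moreover have "h = (\<lambda>i. ?x * ?f i)"
      using p h by (auto simp: fam_grade_def polys_fam_def)
    ultimately show "h \<in> (\<lambda>f i. ?x * f i) ` fam_grade I Z s b"
      by (intro image_eqI[where x = ?f])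
  qed
qed

section \<open>Monotonicity of the Krull dimension\<close>

text \<open>For this set of exponents truncation is the substitution that sends the variables
  outside \<open>Z\<close> to 0.\<close>

lemma polys_in_restrict:
  "restrict_keys {t. Poly_Mapping.keys t \<subseteq> Z} p \<in> polys_in Z"
  by (auto simp: polys_in_def keys_restrict_keys)

lemma restrict_keys_polys_in:
  "p \<in> polys_in Z \<Longrightarrow> restrict_keys {t. Poly_Mapping.keys t \<subseteq> Z} p = p"
  by (rule restrict_keys_id) (auto simp: polys_in_def)

text \<open>The monomials that involve a variable outside \<open>Z\<close> span an ideal, so
  discarding them, which is what \<open>r\<close> does, respects products.\<close>

lemma restrict_keys_mult:
  fixes p q :: "('n, 'k::comm_semiring_1) mpolys" and Z :: "'n set"
  defines "r \<equiv> (restrict_keys {t. Poly_Mapping.keys t \<subseteq> Z} :: ('n, 'k) mpolys \<Rightarrow> _)"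
    and "r' \<equiv> (restrict_keys (- {t. Poly_Mapping.keys t \<subseteq> Z}) :: ('n, 'k) mpolys \<Rightarrow> _)"
  shows "r (p * q) = r p * r q"
proof -
  have r'_left: "r (r' f * h) = 0" for f h
    unfolding r_def r'_def
    using keys_mult[of "restrict_keys (- {t. Poly_Mapping.keys t \<subseteq> Z}) f" h]
    by (intro restrict_keys_eq_zero) (fastforce simp: keys_restrict_keys keys_plus_nat)
  have parts: "r f + r' f = f" for f
    by (simp add: r_def r'_def restrict_keys_compl)
  have "p * q = (r p + r' p) * q"
    by (simp only: parts)
  also have "\<dots> = r p * q + r' p * q"
    by (rule distrib_right)
  also have "\<dots> = r p * (r q + r' q) + r' p * q"
    by (simp only: parts)
  also have "r \<dots> = r (r p * r q) + (r (r' q * r p) + r (r' p * q))"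
    by (simp add: r_def restrict_keys_add algebra_simps)
  also have "\<dots> = r (r p * r q)"
    by (simp add: r'_left)
  also have "\<dots> = r p * r q"
    unfolding r_def by (intro restrict_keys_polys_in mult_in_polys_in polys_in_restrict)
  finally show ?thesis .
qed

lemma cring_polys_in: "cring (subring_of (polys_in Z :: ('n, 'k::comm_ring_1) mpolys set))"
proof (rule cringI)
  show "abelian_group (subring_of (polys_in Z :: ('n, 'k) mpolys set))"
    by (rule abelian_groupI)
      (auto simp: subring_of_def add_in_polys_in algebra_simps
        intro!: bexI[OF _ minus_in_polys_in])
  show "comm_monoid (subring_of (polys_in Z :: ('n, 'k) mpolys set))"
    by (rule comm_monoidI)
      (auto simp: subring_of_def mult_in_polys_in one_in_polys_in algebra_simps)
qed (simp add: subring_of_def algebra_simps)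

text \<open>K[Z] is a retract of K[W]: setting the extra variables to 0 is a ring homomorphism that
  fixes K[Z]. Preimages turn a strict chain of primes of K[Z] into one of K[W] of the same length,
  so no formula for the dimension is required.\<close>

lemma krull_dim_polys_in_mono:
  fixes Z W :: "'n set"
  assumes "Z \<subseteq> W"
  shows "krull_dim (subring_of (polys_in Z :: ('n, 'k::comm_ring_1) mpolys set))
    \<le> krull_dim (subring_of (polys_in W :: ('n, 'k) mpolys set))"
    (is "krull_dim ?R \<le> krull_dim ?S")
proof -
  let ?h = "restrict_keys {t. Poly_Mapping.keys t \<subseteq> Z} :: ('n, 'k) mpolys \<Rightarrow> _"
  have carrier: "carrier ?R \<subseteq> carrier ?S" "carrier ?R = polys_in Z" "carrier ?S = polys_in W"
    using assms by (auto simp: subring_of_def polys_in_def)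
  interpret R: cring ?R by (rule cring_polys_in)
  interpret S: cring ?S by (rule cring_polys_in)
  have hom: "ring_hom_ring ?S ?R ?h"
    using R.ring_axioms S.ring_axioms
    by (intro ring_hom_ringI)
      (auto simp: subring_of_def polys_in_restrict restrict_keys_add restrict_keys_mult
        restrict_keys_polys_in one_in_polys_in)
  have vimage: "primeideal {r \<in> polys_in W. ?h r \<in> P} ?S" if "primeideal P ?R" for P
    using ring_hom_ring.primeideal_vimage[OF hom S.cring_axioms that]
    by (simp only: carrier)
  have psubset: "A \<subset> B" if "x \<in> B" "x \<notin> A" "A \<subseteq> B" for x and A B :: "('n, 'k) mpolys set"
    using that by blast
  define chain :: "('n, 'k) mpolys ring \<Rightarrow> nat \<Rightarrow> bool" where
    "chain R l \<longleftrightarrow> (\<exists>P. (\<forall>i \<le> l. primeideal (P i) R) \<and> (\<forall>i < l. P i \<subset> P (Suc i)))" for R l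
  have "chain ?S l" if P: "\<forall>i \<le> l. primeideal (P i) ?R" "\<forall>i < l. P i \<subset> P (Suc i)"
    for l and P :: "nat \<Rightarrow> ('n, 'k) mpolys set"
    unfolding chain_def
  proof (intro exI[of _ "\<lambda>i. {r \<in> polys_in W. ?h r \<in> P i}"] conjI allI impI)
    fix i assume "i < l"
    then obtain x where x: "x \<in> P (Suc i)" "x \<notin> P i" using P(2) by blast
    have "primeideal (P (Suc i)) ?R" using P \<open>i < l\<close> by simp
    \<comment> \<open>The \<open>x\<close> that separates two primes also separates their preimages,
      since \<open>?h\<close> fixes \<open>polys_in Z\<close> pointwise.\<close>
    then have "x \<in> polys_in Z"
      using x ideal.Icarr[of "P (Suc i)" ?R x] carrier by (simp add: primeideal_def)
    then have "x \<in> polys_in W" "?h x = x"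
      using carrier by (auto simp: restrict_keys_polys_in)
    then have "x \<in> {r \<in> polys_in W. ?h r \<in> P (Suc i)}" "x \<notin> {r \<in> polys_in W. ?h r \<in> P i}"
      using x by simp_all
    moreover have "{r \<in> polys_in W. ?h r \<in> P i} \<subseteq> {r \<in> polys_in W. ?h r \<in> P (Suc i)}"
      using P(2) \<open>i < l\<close> by (intro Collect_mono) blast
    ultimately show "{r \<in> polys_in W. ?h r \<in> P i} \<subset> {r \<in> polys_in W. ?h r \<in> P (Suc i)}"
      by (rule psubset)
  next
    fix i assume "i \<le> l"
    then show "primeideal {r \<in> polys_in W. ?h r \<in> P i} ?S"
      using P(1) by (intro vimage) simp
  qed
  then have "chain ?S l" if "chain ?R l" for l
    using that unfolding chain_def[of ?R] by (elim exE conjE)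
  then have "{enat l | l. chain ?R l} \<subseteq> {enat l | l. chain ?S l}"
    by blast
  then show ?thesis
    unfolding krull_dim_def chain_def by (rule Sup_subset_mono)
qed

section \<open>Decompositions of a multigraded module\<close>

context multigraded_module
begin

text \<open>Restriction of scalars to K gives access to bases and dimension bounds in the single
  degrees.\<close>

interpretation kvs: vector_space "\<lambda>c. scale (const c)"
  by unfold_locales (simp_all add: const_mult_distrib scale_right_distrib scale_left_distrib)

section \<open>Homogeneous components of module elements\<close>

lemma sum_in_grade: "(\<And>i. i \<in> I \<Longrightarrow> f i \<in> G a) \<Longrightarrow> sum f I \<in> G a"
  by (induction I rule: infinite_finite_induct) (auto intro: add_in_grade zero_in_grade)

text \<open>The description is meaningful because \<open>grades_direct_sum\<close> supplies a unique
  \<open>f\<close>.\<close>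

definition hcomp :: "'n mdeg \<Rightarrow> 'm \<Rightarrow> 'm"
  where "hcomp a x = Poly_Mapping.lookup (THE f. (\<forall>i. Poly_Mapping.lookup f i \<in> G i) \<and>
    x = (\<Sum>i \<in> Poly_Mapping.keys f. Poly_Mapping.lookup f i)) a"

lemma hcomp_ex1:
  "\<exists>!f. (\<forall>i. Poly_Mapping.lookup f i \<in> G i) \<and>
    x = (\<Sum>i \<in> Poly_Mapping.keys f. Poly_Mapping.lookup f i)"
  using grades_direct_sum by (simp add: is_direct_sum_def)

lemma hcomp_in_grade: "hcomp a x \<in> G a"
  and finite_hcomp: "finite {a. hcomp a x \<noteq> 0}"
  and sum_hcomp: "x = (\<Sum>a | hcomp a x \<noteq> 0. hcomp a x)"
proof -
  obtain f where f: "\<forall>i. Poly_Mapping.lookup f i \<in> G i"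
      "x = (\<Sum>i \<in> Poly_Mapping.keys f. Poly_Mapping.lookup f i)"
    and hcomp: "hcomp a x = Poly_Mapping.lookup f a" for a
    using theI'[OF hcomp_ex1[of x]] by (auto simp: hcomp_def)
  have nonzero: "{a. hcomp a x \<noteq> 0} = Poly_Mapping.keys f"
    by (auto simp: hcomp in_keys_iff)
  show "hcomp a x \<in> G a"
    using f(1) by (simp only: hcomp)
  show "finite {a. hcomp a x \<noteq> 0}"
    by (simp only: nonzero finite_keys)
  show "x = (\<Sum>a | hcomp a x \<noteq> 0. hcomp a x)"
    unfolding nonzero unfolding hcomp by (rule f(2))
qed

text \<open>By uniqueness, any way of writing \<open>x\<close> as a finite sum over distinct degrees
  reveals its components; the later computations of \<open>hcomp\<close> rest on this.\<close>

lemma hcomp_unique: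
  assumes "finite F" "\<And>a. a \<in> F \<Longrightarrow> y a \<in> G a" "x = (\<Sum>a \<in> F. y a)"
  shows "hcomp b x = (if b \<in> F then y b else 0)"
proof -
  obtain f where f: "Poly_Mapping.lookup f = (\<lambda>i. if i \<in> F then y i else 0)"
    "(\<Sum>i \<in> Poly_Mapping.keys f. Poly_Mapping.lookup f i) = sum y F"
    using ex_poly_mapping_sum[OF assms(1)] .
  then have "(THE f. (\<forall>i. Poly_Mapping.lookup f i \<in> G i) \<and>
      x = (\<Sum>i \<in> Poly_Mapping.keys f. Poly_Mapping.lookup f i)) = f"
    using assms by (intro the1_equality[OF hcomp_ex1]) (auto simp: zero_in_grade)
  then show ?thesis by (simp add: hcomp_def f)
qed

lemma hcomp_grade: "x \<in> G a \<Longrightarrow> hcomp b x = (if b = a then x else 0)"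
  using hcomp_unique[of "{a}" "\<lambda>_. x" x b] by simp

lemma hcomp_add: "hcomp b (x + y) = hcomp b x + hcomp b y"
proof -
  \<comment> \<open>A common finite range of degrees for both elements; outside their own supports
    the components are 0.\<close>
  let ?F = "{a. hcomp a x \<noteq> 0} \<union> {a. hcomp a y \<noteq> 0}"
  have "finite ?F"
    by (simp add: finite_hcomp)
  have sum_F: "z = (\<Sum>a \<in> ?F. hcomp a z)" if "{a. hcomp a z \<noteq> 0} \<subseteq> ?F" for z
    by (rule trans[OF sum_hcomp]) (use \<open>finite ?F\<close> that in \<open>auto intro: sum.mono_neutral_left\<close>)
  have "x + y = (\<Sum>a \<in> ?F. hcomp a x + hcomp a y)"
    unfolding sum.distrib by (rule arg_cong2[where f = "(+)"]; rule sum_F; simp)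
  with \<open>finite ?F\<close> have "hcomp b (x + y) = (if b \<in> ?F then hcomp b x + hcomp b y else 0)"
    by (intro hcomp_unique add_in_grade hcomp_in_grade)
  then show ?thesis by auto
qed

lemma hcomp_zero [simp]: "hcomp b 0 = 0"
  using hcomp_grade[OF zero_in_grade] by simp

lemma hcomp_sum: "hcomp b (sum f I) = (\<Sum>i \<in> I. hcomp b (f i))"
  by (induction I rule: infinite_finite_induct) (simp_all add: hcomp_add)

text \<open>Multiplication of \<open>m\<close> raises degrees by \<open>s\<close>, so degree
  \<open>b\<close> is reached exactly from degree \<open>b - s\<close>. Both sides are additive in
  \<open>p\<close>, which leaves the case of a single monomial.\<close>

lemma hcomp_scale:
  assumes "m \<in> G s"
  shows "hcomp b (scale p m) = scale (hpart (b - s) p) m"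
proof -
  have single: "hcomp b (scale (Poly_Mapping.single t c) m)
      = scale (hpart (b - s) (Poly_Mapping.single t c)) m" for t c
    using scale_in_grade[OF single_in_homogeneous_polys assms, of t c, THEN hcomp_grade, of b]
    by (auto simp: restrict_keys_single)
  have hpart_sum: "hpart a (sum f I) = (\<Sum>i \<in> I. hpart a (f i))"
    for a I and f :: "('n \<Rightarrow>\<^sub>0 nat) \<Rightarrow> ('n, 'k) mpolys"
    by (induction I rule: infinite_finite_induct) (simp_all add: restrict_keys_add)
  show ?thesis
    by (subst (1 2) poly_mapping_expand[of p]) (simp add: hpart_sum scale_sum_left hcomp_sum single)
qed

section \<open>The evaluation map and its bijectivity as criterion for Stanley
  decompositions\<close>

definition ev :: "'i set \<Rightarrow> ('i \<Rightarrow> 'm) \<Rightarrow> ('i \<Rightarrow> ('n, 'k) mpolys) \<Rightarrow> 'm"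
  where "ev I m f = (\<Sum>i \<in> I. scale (f i) (m i))"

lemma ev_zero: "ev I m (\<lambda>i. 0) = 0"
  by (simp add: ev_def)

lemma ev_add: "ev I m (\<lambda>i. f i + h i) = ev I m f + ev I m h"
  by (simp add: ev_def scale_left_distrib sum.distrib)

lemma ev_mult: "ev I m (\<lambda>i. p * f i) = scale p (ev I m f)"
  by (simp add: ev_def scale_sum_right)

lemma ev_sum: "ev I m (\<lambda>i. \<Sum>a \<in> F. f a i) = (\<Sum>a \<in> F. ev I m (f a))"
  by (simp add: ev_def scale_sum_left sum.swap[of _ F])

lemma ev_in_grade:
  assumes "\<And>i. i \<in> I \<Longrightarrow> m i \<in> G (s i)" "f \<in> fam_grade I Z s a"
  shows "ev I m f \<in> G a"
  unfolding ev_def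
proof (rule sum_in_grade)
  fix i assume "i \<in> I"
  then show "scale (f i) (m i) \<in> G a"
    using assms scale_in_grade[of "f i" "a - s i" "m i" "s i"] by (simp add: fam_grade_def)
qed

lemma hcomp_ev:
  assumes "\<And>i. i \<in> I \<Longrightarrow> m i \<in> G (s i)"
  shows "hcomp b (ev I m f) = ev I m (\<lambda>i. hpart (b - s i) (f i))"
  unfolding ev_def hcomp_sum by (intro sum.cong refl hcomp_scale assms)

lemma hpart_fam_grade:
  "f \<in> polys_fam I Z \<Longrightarrow> (\<lambda>i. hpart (b - s i) (f i)) \<in> fam_grade I Z s b"
  by (auto simp: fam_grade_def polys_fam_def hpart_homogeneous hpart_polys_in)

text \<open>Evaluation preserves degrees. If \<open>x\<close> is homogeneous, the part of matching
  degree of any preimage is again a preimage, so surjectivity descends to each degree.\<close>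

lemma bij_betw_fam_grade:
  assumes m: "\<And>i. i \<in> I \<Longrightarrow> m i \<in> G (s i)"
    and bij: "bij_betw (ev I m) (polys_fam I Z) UNIV"
  shows "bij_betw (ev I m) (fam_grade I Z s a) (G a)"
proof (rule bij_betw_imageI)
  show "inj_on (ev I m) (fam_grade I Z s a)"
    using bij by (auto simp: bij_betw_def fam_grade_def elim: inj_on_subset)
  show "ev I m ` fam_grade I Z s a = G a"
  proof (intro equalityI subsetI)
    fix x assume x: "x \<in> G a"
    obtain f where f: "f \<in> polys_fam I Z" "x = ev I m f"
      using bij by (auto simp: bij_betw_def image_iff set_eq_iff)
    have "x = hcomp a x"
      using hcomp_grade[OF x, of a] by simp
    also have "\<dots> = ev I m (\<lambda>i. hpart (a - s i) (f i))"
      unfolding f(2) by (intro hcomp_ev m)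
    finally have "x = ev I m (\<lambda>i. hpart (a - s i) (f i))" .
    then show "x \<in> ev I m ` fam_grade I Z s a"
      using hpart_fam_grade[OF f(1)] by blast
  qed (auto intro: ev_in_grade m)
qed

text \<open>The converse passage from single degrees to the whole module: injectivity is tested on
  homogeneous parts, and a preimage of \<open>x\<close> is the finite sum of preimages of its
  nonzero components.\<close>

lemma bij_betw_polys_fam:
  assumes m: "\<And>i. i \<in> I \<Longrightarrow> m i \<in> G (s i)"
    and bij: "\<And>a. bij_betw (ev I m) (fam_grade I Z s a) (G a)"
  shows "bij_betw (ev I m) (polys_fam I Z) UNIV"
proof (rule bij_betw_imageI)
  show "inj_on (ev I m) (polys_fam I Z)"
  proof (rule inj_onI)
    fix f h assume fh: "f \<in> polys_fam I Z" "h \<in> polys_fam I Z" "ev I m f = ev I m h"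
    have comp: "hcomp a (ev I m f) = ev I m (\<lambda>i. hpart (a - s i) (f i))" for a f
      by (intro hcomp_ev m)
    have parts: "(\<lambda>i. hpart (a - s i) (f i)) = (\<lambda>i. hpart (a - s i) (h i))" for a
    proof (rule inj_onD[OF bij_betw_imp_inj_on[OF bij[of a]]])
      show "ev I m (\<lambda>i. hpart (a - s i) (f i)) = ev I m (\<lambda>i. hpart (a - s i) (h i))"
        using arg_cong[OF fh(3), of "hcomp a"] unfolding comp .
    qed (intro hpart_fam_grade fh)+
    show "f = h"
    proof (rule ext, rule hpart_eqI)
      fix i a
      \<comment> \<open>Degree \<open>a\<close> in the coefficient at \<open>i\<close> corresponds
        to degree \<open>a + s i\<close> in the module.\<close>
      show "hpart a (f i) = hpart a (h i)"
        using parts[of "a + s i", THEN fun_cong, of i] by simp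
    qed
  qed
  show "ev I m ` polys_fam I Z = UNIV"
  proof (intro equalityI subsetI)
    fix x
    have "\<exists>f. f \<in> fam_grade I Z s a \<and> ev I m f = hcomp a x" for a
      using bij_betw_imp_surj_on[OF bij, of a] hcomp_in_grade[of a x] by (metis imageE)
    then obtain f where f: "\<And>a. f a \<in> fam_grade I Z s a" "\<And>a. ev I m (f a) = hcomp a x"
      by metis
    let ?h = "\<lambda>i. \<Sum>a | hcomp a x \<noteq> 0. f a i"
    have "ev I m ?h = x"
      unfolding ev_sum f by (rule sum_hcomp[symmetric])
    moreover have "?h \<in> polys_fam I Z"
      using f(1) by (auto simp: polys_fam_def fam_grade_def intro!: sum_in_polys_in)
    ultimately show "x \<in> ev I m ` polys_fam I Z"
      by (rule image_eqI[OF sym])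
  qed simp
qed

text \<open>Induction on the total degree of X^t, splitting off one variable at a time. The
  condition a_k \<ge> g_k survives because multiplication by the other variables never lowers a
  degree.\<close>

lemma bij_betw_monomial:
  assumes "positively_determined scale G g"
    and "\<And>j. j \<in> Poly_Mapping.keys t \<Longrightarrow> int (g j) \<le> a j"
  shows "bij_betw (scale (Poly_Mapping.single t 1)) (G a) (G (a + tdeg t))"
  using assms(2)
proof (induction "\<Sum>j \<in> UNIV. Poly_Mapping.lookup t j" arbitrary: t)
  case 0
  then have "t = 0" by (intro poly_mapping_eqI) simp
  then show ?case
    by (simp add: tdeg_zero bij_betw_def inj_on_def)
next
  case (Suc N)
  then obtain k where k: "Poly_Mapping.lookup t k \<noteq> 0"
    by (metis Zero_not_Suc sum.neutral)
  define u where "u = t - Poly_Mapping.single k 1"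
  have t: "t = u + Poly_Mapping.single k 1"
    using k by (intro poly_mapping_eqI) (auto simp: u_def lookup_minus lookup_add lookup_single when_def)
  have deg: "tdeg t = tdeg u + unit_deg k"
    unfolding t tdeg_add by (auto simp: tdeg_def unit_deg_def lookup_single when_def)
  have keys: "Poly_Mapping.keys t = Poly_Mapping.keys u \<union> {k}"
    by (simp add: t keys_plus_nat)
  have "(\<Sum>j \<in> UNIV. Poly_Mapping.lookup t j) = (\<Sum>j \<in> UNIV. Poly_Mapping.lookup u j) + 1"
    by (simp add: t lookup_add sum.distrib lookup_single when_def)
  then have u: "bij_betw (scale (Poly_Mapping.single u 1)) (G a) (G (a + tdeg u))"
    using Suc.hyps(2) Suc.prems by (intro Suc.hyps(1)) (auto simp: keys)
  have "int (g k) \<le> (a + tdeg u) k"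
    using Suc.prems[of k] tdeg_nonneg[of u k] by (simp add: keys)
  then have "bij_betw (scale (var k)) (G (a + tdeg u)) (G (a + tdeg u + unit_deg k))"
    using assms(1) by (auto simp: positively_determined_def)
  moreover have "scale (var k) \<circ> scale (Poly_Mapping.single u 1) = scale (Poly_Mapping.single t 1)"
    by (rule ext) (simp add: t var_def mult_single add.commute)
  ultimately show ?case
    using bij_betw_trans[OF u] by (metis deg add.assoc)
qed

text \<open>The family with \<open>p\<close> at position \<open>i\<close> and 0 elsewhere would have
  the same value as the zero family.\<close>

lemma annihilator_bij_ev:
  assumes "bij_betw (ev I m) (polys_fam I Z) UNIV" "finite I" "i \<in> I" "p \<in> polys_in (Z i)"
    and "scale p (m i) = 0"
  shows "p = 0"
proof -
  let ?f = "\<lambda>k. if k = i then p else 0"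
  have "ev I m ?f = (\<Sum>k \<in> I. if k = i then scale p (m i) else 0)"
    unfolding ev_def by (intro sum.cong) auto
  then have "ev I m ?f = ev I m (\<lambda>_. 0)"
    using assms(2,3,5) by (simp add: ev_zero)
  moreover have "?f \<in> polys_fam I Z" "(\<lambda>_. 0) \<in> polys_fam I Z"
    using assms(3,4) by (auto simp: polys_fam_def)
  ultimately have "?f = (\<lambda>_. 0)"
    using inj_onD[OF bij_betw_imp_inj_on[OF assms(1)]] by blast
  then show ?thesis by (metis (full_types))
qed

text \<open>Directness makes the summands r_i m_i of an element unique, and the annihilator
  condition recovers r_i from r_i m_i. Together they say that each element is the value of exactly
  one coefficient family.\<close>

lemma is_direct_sum_iff_bij_ev:
  assumes "finite I"
  shows "(\<forall>i \<in> I. polys_in (Z i) \<inter> {r. scale r (m i) = 0} = {0}) \<and>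
      is_direct_sum (\<lambda>i. (\<lambda>r. scale r (m i)) ` polys_in (Z i)) I \<longleftrightarrow>
    bij_betw (ev I m) (polys_fam I Z) UNIV"
proof (intro iffI conjI)
  let ?N = "\<lambda>i. (\<lambda>r. scale r (m i)) ` polys_in (Z i)"
  \<comment> \<open>From coefficients r_i to the summands r_i m_i; \<open>coeffs\<close> below goes
    the other way by choosing coefficients.\<close>
  have summands: "\<exists>F. Poly_Mapping.lookup F = (\<lambda>i. if i \<in> I then scale (f i) (m i) else 0) \<and>
      Poly_Mapping.keys F \<subseteq> I \<and> (\<forall>i \<in> I. Poly_Mapping.lookup F i \<in> ?N i) \<and>
      ev I m f = (\<Sum>i \<in> Poly_Mapping.keys F. Poly_Mapping.lookup F i)"
    if "f \<in> polys_fam I Z" for f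
  proof -
    obtain F where "Poly_Mapping.lookup F = (\<lambda>i. if i \<in> I then scale (f i) (m i) else 0)"
      "Poly_Mapping.keys F \<subseteq> I"
      "(\<Sum>i \<in> Poly_Mapping.keys F. Poly_Mapping.lookup F i) = (\<Sum>i \<in> I. scale (f i) (m i))"
      using ex_poly_mapping_sum[OF assms] .
    with that show ?thesis
      by (intro exI[of _ F]) (auto simp: ev_def polys_fam_def)
  qed
  have coeffs: "\<exists>f \<in> polys_fam I Z. (\<forall>i \<in> I. Poly_Mapping.lookup F i = scale (f i) (m i)) \<and>
      ev I m f = (\<Sum>i \<in> Poly_Mapping.keys F. Poly_Mapping.lookup F i)"
    if F: "Poly_Mapping.keys F \<subseteq> I" "\<forall>i \<in> I. Poly_Mapping.lookup F i \<in> ?N i" for F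
  proof -
    from F(2) have "\<forall>i \<in> I. \<exists>r \<in> polys_in (Z i). Poly_Mapping.lookup F i = scale r (m i)"
      by blast
    then obtain r where r: "\<And>i. i \<in> I \<Longrightarrow> r i \<in> polys_in (Z i) \<and> Poly_Mapping.lookup F i = scale (r i) (m i)"
      by metis
    let ?f = "\<lambda>i. if i \<in> I then r i else 0"
    have "?f \<in> polys_fam I Z"
      using r by (auto simp: polys_fam_def)
    moreover have "ev I m ?f = (\<Sum>i \<in> Poly_Mapping.keys F. Poly_Mapping.lookup F i)"
      unfolding sum_lookup_keys[OF assms F(1)] ev_def using r by (intro sum.cong) auto
    ultimately show ?thesis
      using r by (intro bexI[of _ ?f]) auto
  qed
  {
    assume *: "(\<forall>i \<in> I. polys_in (Z i) \<inter> {r. scale r (m i) = 0} = {0}) \<and> is_direct_sum ?N I"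
    then have ex1: "\<exists>!F. Poly_Mapping.keys F \<subseteq> I \<and> (\<forall>i \<in> I. Poly_Mapping.lookup F i \<in> ?N i) \<and>
        x = (\<Sum>i \<in> Poly_Mapping.keys F. Poly_Mapping.lookup F i)" for x
      by (simp add: is_direct_sum_def)
    show "bij_betw (ev I m) (polys_fam I Z) UNIV"
    proof (rule bij_betw_imageI)
      show "inj_on (ev I m) (polys_fam I Z)"
      proof (rule inj_onI)
        fix f h assume fh: "f \<in> polys_fam I Z" "h \<in> polys_fam I Z" "ev I m f = ev I m h"
        obtain F where F: "Poly_Mapping.lookup F = (\<lambda>i. if i \<in> I then scale (f i) (m i) else 0)"
          "Poly_Mapping.keys F \<subseteq> I" "\<forall>i \<in> I. Poly_Mapping.lookup F i \<in> ?N i"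
          "ev I m f = (\<Sum>i \<in> Poly_Mapping.keys F. Poly_Mapping.lookup F i)"
          using summands[OF fh(1)] by blast
        obtain H where H: "Poly_Mapping.lookup H = (\<lambda>i. if i \<in> I then scale (h i) (m i) else 0)"
          "Poly_Mapping.keys H \<subseteq> I" "\<forall>i \<in> I. Poly_Mapping.lookup H i \<in> ?N i"
          "ev I m h = (\<Sum>i \<in> Poly_Mapping.keys H. Poly_Mapping.lookup H i)"
          using summands[OF fh(2)] by blast
        have "F = H"
        proof (rule ex1_unique[OF ex1[of "ev I m f"]])
          show "Poly_Mapping.keys F \<subseteq> I \<and> (\<forall>i \<in> I. Poly_Mapping.lookup F i \<in> ?N i) \<and>
              ev I m f = (\<Sum>i \<in> Poly_Mapping.keys F. Poly_Mapping.lookup F i)"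
            by (intro conjI F(2-4))
          show "Poly_Mapping.keys H \<subseteq> I \<and> (\<forall>i \<in> I. Poly_Mapping.lookup H i \<in> ?N i) \<and>
              ev I m f = (\<Sum>i \<in> Poly_Mapping.keys H. Poly_Mapping.lookup H i)"
            unfolding fh(3) by (intro conjI H(2-4))
        qed
        show "f = h"
        proof
          fix i
          show "f i = h i"
          proof (cases "i \<in> I")
            case True
            \<comment> \<open>Equal summands only give a difference of coefficients that kills
              \<open>m i\<close>; this is where the annihilator condition enters.\<close>
            then have "scale (f i - h i) (m i) = 0"
              using fun_cong[OF F(1), of i] fun_cong[OF H(1), of i] \<open>F = H\<close>
              by (simp add: scale_left_diff_distrib)
            then have "f i - h i \<in> polys_in (Z i) \<inter> {r. scale r (m i) = 0}"
              using True fh by (auto intro: diff_in_polys_in polys_famD)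
            with * True show ?thesis by auto
          qed (use fh in \<open>simp add: polys_fam_def\<close>)
        qed
      qed
      show "ev I m ` polys_fam I Z = UNIV"
      proof (intro equalityI subsetI)
        fix x
        obtain F where F: "Poly_Mapping.keys F \<subseteq> I" "\<forall>i \<in> I. Poly_Mapping.lookup F i \<in> ?N i"
          "x = (\<Sum>i \<in> Poly_Mapping.keys F. Poly_Mapping.lookup F i)"
          using ex1_implies_ex[OF ex1[of x]] by blast
        show "x \<in> ev I m ` polys_fam I Z"
          unfolding F(3) using coeffs[OF F(1,2)] by (metis imageI)
      qed simp
    qed
  next
    assume bij: "bij_betw (ev I m) (polys_fam I Z) UNIV"
    show "\<forall>i \<in> I. polys_in (Z i) \<inter> {r. scale r (m i) = 0} = {0}"
      using annihilator_bij_ev[OF bij assms] by auto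
    show "is_direct_sum ?N I"
      unfolding is_direct_sum_def
    proof (intro allI ex_ex1I)
      fix x
      obtain f where "f \<in> polys_fam I Z" "x = ev I m f"
        using bij_betw_imp_surj_on[OF bij] by (metis UNIV_I imageE)
      then show "\<exists>F. Poly_Mapping.keys F \<subseteq> I \<and> (\<forall>i \<in> I. Poly_Mapping.lookup F i \<in> ?N i) \<and>
          x = (\<Sum>i \<in> Poly_Mapping.keys F. Poly_Mapping.lookup F i)"
        using summands[of f] by blast
    next
      fix x F H
      assume F: "Poly_Mapping.keys F \<subseteq> I \<and> (\<forall>i \<in> I. Poly_Mapping.lookup F i \<in> ?N i) \<and>
          x = (\<Sum>i \<in> Poly_Mapping.keys F. Poly_Mapping.lookup F i)"
        and H: "Poly_Mapping.keys H \<subseteq> I \<and> (\<forall>i \<in> I. Poly_Mapping.lookup H i \<in> ?N i) \<and>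
          x = (\<Sum>i \<in> Poly_Mapping.keys H. Poly_Mapping.lookup H i)"
      note F = conjunct1[OF F] conjunct1[OF conjunct2[OF F]] conjunct2[OF conjunct2[OF F]]
      note H = conjunct1[OF H] conjunct1[OF conjunct2[OF H]] conjunct2[OF conjunct2[OF H]]
      obtain f where f: "f \<in> polys_fam I Z" "\<forall>i \<in> I. Poly_Mapping.lookup F i = scale (f i) (m i)"
        "ev I m f = (\<Sum>i \<in> Poly_Mapping.keys F. Poly_Mapping.lookup F i)"
        using coeffs[OF F(1,2)] by blast
      obtain h where h: "h \<in> polys_fam I Z" "\<forall>i \<in> I. Poly_Mapping.lookup H i = scale (h i) (m i)"
        "ev I m h = (\<Sum>i \<in> Poly_Mapping.keys H. Poly_Mapping.lookup H i)"
        using coeffs[OF H(1,2)] by blast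
      have "ev I m f = ev I m h"
        unfolding f(3) h(3) by (rule trans[OF F(3)[symmetric] H(3)])
      then have "f = h"
        using inj_onD[OF bij_betw_imp_inj_on[OF bij]] f(1) h(1) by blast
      show "F = H"
      proof (rule poly_mapping_eqI)
        fix i
        show "Poly_Mapping.lookup F i = Poly_Mapping.lookup H i"
        proof (cases "i \<in> I")
          case True
          then show ?thesis
            using bspec[OF f(2)] bspec[OF h(2)] \<open>f = h\<close> by metis
        next
          case False
          then have "i \<notin> Poly_Mapping.keys F" "i \<notin> Poly_Mapping.keys H"
            using F(1) H(1) by blast+
          then show ?thesis
            by (simp add: not_in_keys_iff_lookup_eq_zero)
        qed
      qed
    qed
  }
qed

lemma stanley_decomposition_map:
  "stanley_decomposition scale G (map (\<lambda>i. (polys_in (Z i), m i)) [0..<n]) \<longleftrightarrow>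
    (\<forall>i<n. \<exists>a. m i \<in> G a) \<and> bij_betw (ev {..<n} m) (polys_fam {..<n} Z) UNIV"
proof -
  let ?E = "map (\<lambda>i. (polys_in (Z i), m i)) [0..<n]"
  have "is_direct_sum (\<lambda>i. (\<lambda>r. scale r (snd (?E ! i))) ` fst (?E ! i)) {..<n}
      \<longleftrightarrow> is_direct_sum (\<lambda>i. (\<lambda>r. scale r (m i)) ` polys_in (Z i)) {..<n}"
    by (intro is_direct_sum_cong) simp
  then show ?thesis
    unfolding stanley_decomposition_def is_direct_sum_iff_bij_ev[OF finite_lessThan, symmetric]
    by auto
qed

lemma stanley_decompositionE:
  assumes "stanley_decomposition scale G E"
  obtains n Z s m where "E = map (\<lambda>i. (polys_in (Z i), m i)) [0..<n]"
    "\<And>i. i < n \<Longrightarrow> m i \<in> G (s i)" "bij_betw (ev {..<n} m) (polys_fam {..<n} Z) UNIV"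
proof -
  have "\<forall>i < length E. \<exists>Z. fst (E ! i) = polys_in Z"
    using assms nth_mem[of _ E] unfolding stanley_decomposition_def by (fastforce simp: case_prod_beta)
  then obtain Z where Z: "\<And>i. i < length E \<Longrightarrow> fst (E ! i) = polys_in (Z i)"
    by metis
  have E: "E = map (\<lambda>i. (polys_in (Z i), snd (E ! i))) [0..<length E]"
    by (rule nth_equalityI) (simp_all add: Z[symmetric])
  have "(\<forall>i<length E. \<exists>a. snd (E ! i) \<in> G a) \<and>
      bij_betw (ev {..<length E} (\<lambda>i. snd (E ! i))) (polys_fam {..<length E} Z) UNIV"
    using assms unfolding stanley_decomposition_map[symmetric] by (simp flip: E)
  then show thesis
    using that[OF E] by metis
qed

text \<open>The inverse of the evaluation map is the required graded K-linear isomorphism.\<close>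

lemma hilbert_decomposition_map:
  assumes m: "\<And>i. i < n \<Longrightarrow> m i \<in> G (s i)"
    and bij: "bij_betw (ev {..<n} m) (polys_fam {..<n} Z) UNIV"
  shows "hilbert_decomposition scale G (map (\<lambda>i. (polys_in (Z i), s i)) [0..<n])"
  unfolding hilbert_decomposition_def shifted_sum_map shifted_sum_grade_map
proof (intro conjI exI allI)
  let ?P = "polys_fam {..<n} Z :: (nat \<Rightarrow> ('n, 'k) mpolys) set" and ?ev = "ev {..<n} m"
  define \<phi> where "\<phi> = inv_into ?P ?ev"
  have \<phi>: "\<phi> x \<in> ?P" "?ev (\<phi> x) = x" for x
  proof -
    have "x \<in> ?ev ` ?P" using bij by (simp add: bij_betw_def)
    then show "\<phi> x \<in> ?P" "?ev (\<phi> x) = x"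
      unfolding \<phi>_def by (rule inv_into_into, rule f_inv_into_f)
  qed
  \<comment> \<open>To compute \<phi> it suffices, by injectivity of evaluation, to guess a family
    with the right value; linearity of \<phi> thus comes from linearity of
    \<open>ev\<close>.\<close>
  have \<phi>_eqI: "\<phi> x = f" if "f \<in> ?P" "?ev f = x" for x f
    using that bij by (auto simp: \<phi>_def bij_betw_def intro!: inv_into_f_eq)
  have "\<phi> (x + y) = \<phi> x + \<phi> y" for x y
    using \<phi>[of x] \<phi>[of y]
    by (intro \<phi>_eqI) (auto simp: polys_fam_def plus_fun_def ev_add intro: add_in_polys_in)
  moreover have "\<phi> (scale (const c) x) = (\<lambda>i. const c * \<phi> x i)" for c x
    using \<phi>[of x]
    by (intro \<phi>_eqI) (auto simp: polys_fam_def ev_mult intro: mult_in_polys_in const_in_polys_in)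
  ultimately show "Vector_Spaces.linear (\<lambda>c. scale (const c)) (\<lambda>c f i. const c * f i) \<phi>"
    using kvs.vector_space_axioms vector_space_fun
    by (intro linear_module_homI module_hom.intro module_hom_axioms.intro)
      (simp_all add: module_iff_vector_space)
  show "bij_betw \<phi> UNIV ?P"
    unfolding \<phi>_def by (rule bij_betw_inv_into[OF bij])
  show "\<phi> ` G a = fam_grade {..<n} Z s a" for a
  proof -
    have "?ev ` fam_grade {..<n} Z s a = G a"
      using m by (intro bij_betw_imp_surj_on bij_betw_fam_grade bij) auto
    moreover have "\<phi> (?ev f) = f" if "f \<in> fam_grade {..<n} Z s a" for f
      using that by (intro \<phi>_eqI) (simp_all add: fam_grade_def)
    ultimately show ?thesis
      by (metis (no_types, lifting) image_cong image_ident image_image)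
  qed
qed auto

section \<open>Constructing g-determined decompositions from data in the box\<close>

text \<open>An enumeration of \<open>I\<close> turns the family into lists. Of the resulting list
  only its set of entries is recorded, which is all that the depth depends on.\<close>

lemma ex_determined_decomposition:
  assumes "finite I" and m: "\<And>i. i \<in> I \<Longrightarrow> m i \<in> G (s i)"
    and bij: "bij_betw (ev I m) (polys_fam I Z) UNIV"
    and s: "\<And>i. i \<in> I \<Longrightarrow> s i \<in> degree_box g"
  obtains D where "determined_hilbert_decomposition scale G g D" "induced_by_stanley scale G D"
    "set D = (\<lambda>i. (polys_in (Z i), s i)) ` I"
proof -
  define n where "n = card I"
  obtain h where h: "bij_betw h {..<n} I"
    using ex_bij_betw_nat_finite[OF \<open>finite I\<close>] by (auto simp: n_def atLeast0LessThan)
  then have hI: "h k \<in> I" if "k < n" for k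
    using that by (auto simp: bij_betw_def)
  have "ev {..<n} (m \<circ> h) (\<lambda>k. if k \<in> {..<n} then f (h k) else 0) = ev I m f" for f
    unfolding ev_def using sum.reindex_bij_betw[OF h, of "\<lambda>i. scale (f i) (m i)"]
    by (simp add: o_def)
  then have "bij_betw (ev {..<n} (m \<circ> h)) (polys_fam {..<n} (Z \<circ> h)) UNIV"
    by (subst bij_betw_comp_iff[OF bij_betw_reindex_polys_fam[OF h, of Z]])
      (use bij in \<open>simp add: o_def\<close>)
  note bij' = this[unfolded o_def]
  have m': "m (h k) \<in> G (s (h k))" if "k < n" for k
    using m hI that by blast
  let ?D = "map (\<lambda>k. (polys_in (Z (h k)), s (h k))) [0..<n]"
  let ?E = "map (\<lambda>k. (polys_in (Z (h k)), m (h k))) [0..<n]"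
  have "determined_hilbert_decomposition scale G g ?D"
    using hilbert_decomposition_map[OF m' bij'] s hI
    by (auto simp: determined_hilbert_decomposition_def le_fun_def degree_box_def)
  moreover have "stanley_decomposition scale G ?E"
    using m' bij' unfolding stanley_decomposition_map by blast
  then have "induced_by_stanley scale G ?D"
    unfolding induced_by_stanley_def
    by (intro exI[of _ ?E]) (use m' in \<open>auto simp: list_all2_conv_all_nth\<close>)
  moreover have "set ?D = (\<lambda>i. (polys_in (Z i), s i)) ` I"
    using h by (auto simp: bij_betw_def)
  ultimately show thesis using that by blast
qed

text \<open>
  For \<open>b = min a g\<close>, multiplication by the monomial of degree \<open>a - b\<close> identifies the degree \<open>b\<close>
  parts of both sides with their degree \<open>a\<close> parts.
\<close>

lemma bij_betw_ev_of_degree_box: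
  assumes pd: "positively_determined scale G g"
    and s: "\<And>i. i \<in> I \<Longrightarrow> s i \<in> degree_box g"
    and Z: "\<And>i j. i \<in> I \<Longrightarrow> s i j = int (g j) \<Longrightarrow> j \<in> Z i"
    and m: "\<And>i. i \<in> I \<Longrightarrow> m i \<in> G (s i)"
    and box: "\<And>b. b \<in> degree_box g \<Longrightarrow> bij_betw (ev I m) (fam_grade I Z s b) (G b)"
  shows "bij_betw (ev I m) (polys_fam I Z) UNIV"
proof (rule bij_betw_polys_fam[OF m])
  fix a
  show "bij_betw (ev I m) (fam_grade I Z s a) (G a)"
  proof (cases "\<forall>j. 0 \<le> a j")
    case True
    define b where "b = (\<lambda>j. min (a j) (int (g j)))"
    have "b \<in> degree_box g"
      using True by (auto simp: b_def degree_box_def)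
    have "0 \<le> (a - b) j" for j
      by (simp add: b_def)
    then obtain t where t: "tdeg t = a - b"
      using ex_tdeg by blast
    let ?x = "Poly_Mapping.single t 1 :: ('n, 'k) mpolys"
    \<comment> \<open>X^t involves only variables with a_j > g_j, and for these b_j = g_j, so
      multiplication by X^t is bijective on M_b.\<close>
    have "int (g j) \<le> b j" if "j \<in> Poly_Mapping.keys t" for j
      using that fun_cong[OF t, of j] by (auto simp: tdeg_def b_def in_keys_iff min_def split: if_splits)
    then have "bij_betw (scale ?x) (G b) (G (b + tdeg t))"
      by (rule bij_betw_monomial[OF pd])
    then have x: "bij_betw (scale ?x) (G b) (G a)"
      by (simp add: t)
    have "bij_betw (scale ?x \<circ> ev I m) (fam_grade I Z s b) (G a)"
      by (rule bij_betw_trans[OF box x]) fact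
    \<comment> \<open>Evaluation commutes with multiplication by X^t. So the composite bijection out
      of degree \<open>b\<close> is also the shift of coefficient families followed by evaluation in
      degree \<open>a\<close>, and the shift, being bijective, can be cancelled.\<close>
    then show ?thesis
      using bij_betw_comp_iff[OF single_mult_fam_grade[OF s Z b_def t], where f' = "ev I m" and A'' = "G a"]
      by (simp add: o_def ev_mult)
  next
    case False
    then have "G a = {0}"
      using pd by (auto simp: positively_determined_def)
    \<comment> \<open>A nonzero coefficient would force \<open>s i\<close> \<le> \<open>a\<close>,
      but \<open>s i\<close> is nonnegative and \<open>a\<close> is not. So both sides vanish in
      such degrees.\<close>
    moreover have "f = (\<lambda>_. 0)" if f: "f \<in> fam_grade I Z s a" for f :: "_ \<Rightarrow> ('n, 'k) mpolys"
    proof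
      fix i
      show "f i = 0"
      proof (cases "i \<in> I")
        case True
        then have "f i \<in> homogeneous_polys (a - s i)"
          using f by (simp add: fam_grade_def)
        then show ?thesis
        proof (rule homogeneous_polys_cases)
          fix t assume "tdeg t = a - s i"
          then have "s i j \<le> a j" for j
            using tdeg_nonneg[of t j] by simp
          moreover obtain j where "a j < 0"
            using False by (auto simp: not_le)
          ultimately show ?thesis
            using s[OF True] by (force simp: degree_box_def dest: order_trans[of 0 "s i j" "a j"])
        qed
      qed (use f in \<open>simp add: fam_grade_def polys_fam_def\<close>)
    qed
    then have "fam_grade I Z s a = {\<lambda>_. 0 :: ('n, 'k) mpolys}"
      by (auto simp: fam_grade_def polys_fam_def)
    ultimately show ?thesis
      by (simp add: bij_betw_def ev_zero)
  qed
qed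

text \<open>The generators \<open>m i\<close> are kept; only summands are lost and algebras
  enlarged. Both can only raise the minimum of the dimensions, the latter by
  \<open>krull_dim_polys_in_mono\<close>.\<close>

lemma stanley_decomposition_improve:
  assumes pd: "positively_determined scale G g" and E: "stanley_decomposition scale G E"
  obtains D where "determined_hilbert_decomposition scale G g D" "induced_by_stanley scale G D"
    "decomposition_depth E \<le> decomposition_depth D"
proof -
  obtain n Z s m where E_eq: "E = map (\<lambda>i. (polys_in (Z i), m i)) [0..<n]"
    and m: "\<And>i. i < n \<Longrightarrow> m i \<in> G (s i)"
    and bij: "bij_betw (ev {..<n} m) (polys_fam {..<n} Z) UNIV"
    by (rule stanley_decompositionE[OF E]) (rule that)
  define I where "I = {i \<in> {..<n}. s i \<le> (\<lambda>j. int (g j))}"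
  define Z' where "Z' i = Z i \<union> {j. s i j = int (g j)}" for i
  have "finite I" and I: "\<And>i. i \<in> I \<Longrightarrow> i < n"
    by (auto simp: I_def)
  have box: "s i \<in> degree_box g" if "i \<in> I" for i
  proof -
    \<comment> \<open>The polynomial 1 lies in every subalgebra and may not annihilate
      \<open>m i\<close>. Hence M is nonzero in degree \<open>s i\<close>, which must therefore be
      nonnegative.\<close>
    have "m i \<noteq> 0"
      using annihilator_bij_ev[OF bij, of i 1] I[OF that] one_in_polys_in by auto
    then have "G (s i) \<noteq> {0}"
      using m[OF I[OF that]] by auto
    then have "\<forall>k. 0 \<le> s i k"
      using pd unfolding positively_determined_def by blast
    with that show ?thesis
      by (auto simp: degree_box_def I_def le_fun_def)
  qed
  have "bij_betw (ev I m) (fam_grade I Z' s b) (G b)" if b: "b \<in> degree_box g" for b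
  proof -
    \<comment> \<open>Dropped summands do not reach the box: a nonzero coefficient in degree
      \<open>b\<close> needs \<open>s i\<close> \<le> \<open>b\<close> \<le>
      \<open>g\<close>.\<close>
    have outside: "f i = 0" if f: "f \<in> fam_grade {..<n} Z s b" and "i \<notin> I"
      for f :: "nat \<Rightarrow> ('n, 'k) mpolys" and i
    proof (cases "i < n")
      case True
      then have "f i \<in> homogeneous_polys (b - s i)"
        using f by (simp add: fam_grade_def)
      then show ?thesis
      proof (rule homogeneous_polys_cases)
        fix t assume t: "tdeg t = b - s i"
        have "s i j \<le> int (g j)" for j
          using tdeg_nonneg[of t j] b t by (auto simp: degree_box_def intro: order_trans[of _ "b j"])
        then show ?thesis
          using True \<open>i \<notin> I\<close> by (simp add: I_def le_fun_def)
      qed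
    qed (use f in \<open>simp add: fam_grade_def polys_fam_def\<close>)
    \<comment> \<open>A variable added to Z_i has s_ij = g_j \<ge> b_j, so it cannot occur with
      positive exponent in degree \<open>b\<close>.\<close>
    have inside: "p \<in> polys_in (Z i)" if "i \<in> I" and p: "p \<in> polys_in (Z' i)" "p \<in> homogeneous_polys (b - s i)"
      for p :: "('n, 'k) mpolys" and i
      using p(2)
    proof (rule homogeneous_polys_cases)
      fix t c assume t: "tdeg t = b - s i" "c \<noteq> 0" "p = Poly_Mapping.single t c"
      have "j \<in> Z i" if "j \<in> Poly_Mapping.keys t" for j
      proof -
        have "s i j \<noteq> int (g j)"
          using fun_cong[OF t(1), of j] that b by (auto simp: tdeg_def in_keys_iff degree_box_def
            dest: spec[of _ j])
        then show ?thesis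
          using p(1) t that by (auto simp: polys_in_def Z'_def)
      qed
      then show ?thesis
        using t by (auto simp: polys_in_def)
    qed simp
    have in_Z': "p \<in> polys_in (Z i) \<Longrightarrow> p \<in> polys_in (Z' i)" for p :: "('n, 'k) mpolys" and i
      by (auto simp: polys_in_def Z'_def)
    have grade: "fam_grade I Z' s b = (fam_grade {..<n} Z s b :: (nat \<Rightarrow> ('n, 'k) mpolys) set)"
    proof (intro equalityI subsetI)
      fix f :: "nat \<Rightarrow> ('n, 'k) mpolys" assume f: "f \<in> fam_grade I Z' s b"
      have "f i \<in> polys_in (Z i) \<and> f i \<in> homogeneous_polys (b - s i)" for i
        using f inside[of i "f i"] by (cases "i \<in> I") (auto simp: fam_grade_def polys_fam_def)
      moreover have "f i = 0" if "\<not> i < n" for i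
        using f I that by (auto simp: fam_grade_def polys_fam_def)
      ultimately show "f \<in> fam_grade {..<n} Z s b"
        by (simp add: fam_grade_def polys_fam_def)
    next
      fix f :: "nat \<Rightarrow> ('n, 'k) mpolys" assume f: "f \<in> fam_grade {..<n} Z s b"
      then show "f \<in> fam_grade I Z' s b"
        using outside[OF f] I in_Z' by (auto simp: fam_grade_def polys_fam_def)
    qed
    have "bij_betw (ev {..<n} m) (fam_grade {..<n} Z s b) (G b)"
      using m by (intro bij_betw_fam_grade bij) simp
    moreover have "ev {..<n} m f = ev I m f" if "f \<in> fam_grade {..<n} Z s b" for f
      unfolding ev_def using outside[OF that] I by (intro sum.mono_neutral_right) auto
    ultimately show ?thesis
      unfolding grade using bij_betw_cong[of "fam_grade {..<n} Z s b" "ev {..<n} m" "ev I m" "G b"]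
      by simp
  qed
  then have bij': "bij_betw (ev I m) (polys_fam I Z') UNIV"
    using m I by (intro bij_betw_ev_of_degree_box[OF pd box]) (auto simp: Z'_def)
  obtain D where D: "determined_hilbert_decomposition scale G g D" "induced_by_stanley scale G D"
    "set D = (\<lambda>i. (polys_in (Z' i), s i)) ` I"
    by (rule ex_determined_decomposition[OF \<open>finite I\<close> m[OF I] bij' box]) (assumption | rule that)+
  have "decomposition_depth E \<le> decomposition_depth D"
    unfolding decomposition_depth_def D(3)
  proof (rule INF_greatest)
    fix x assume "x \<in> (\<lambda>i. (polys_in (Z' i) :: ('n, 'k) mpolys set, s i)) ` I"
    then obtain i where i: "i \<in> I" "x = (polys_in (Z' i), s i)" by blast
    have "(INF (A, x) \<in> set E. krull_dim (subring_of A))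
        \<le> krull_dim (subring_of (polys_in (Z i) :: ('n, 'k) mpolys set))"
      using I[OF i(1)] by (intro INF_lower2[of "(polys_in (Z i), m i)"]) (auto simp: E_eq)
    also have "\<dots> \<le> krull_dim (subring_of (polys_in (Z' i) :: ('n, 'k) mpolys set))"
      by (rule krull_dim_polys_in_mono) (simp add: Z'_def)
    finally show "(INF (A, x) \<in> set E. krull_dim (subring_of A))
        \<le> (case x of (A, x) \<Rightarrow> krull_dim (subring_of A))"
      by (simp add: i)
  qed
  with D show thesis using that by blast
qed

section \<open>Existence and finiteness of g-determined decompositions\<close>

text \<open>Over K, M_b is spanned by the multiples X^t v_c with t = b - c, where v_c runs through
  the homogeneous components of the generators \<open>v\<close>. Each \<open>v\<close> has finitely
  many nonzero components, and each allows at most one t.\<close>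

lemma finite_spanning_grade:
  assumes "finitely_generated scale"
  obtains T where "finite T" "G b \<subseteq> kvs.span T"
proof -
  obtain S where S: "finite S" "span S = UNIV"
    using assms by (auto simp: finitely_generated_def)
  define T where "T = (\<Union>v \<in> S. \<Union>c \<in> {c. hcomp c v \<noteq> 0}.
    (\<lambda>t. scale (Poly_Mapping.single t 1) (hcomp c v)) ` {t. tdeg t = b - c})"
  have "finite T"
    unfolding T_def by (intro finite_UN_I finite_imageI S finite_hcomp finite_tdeg_fiber)
  moreover have "x \<in> kvs.span T" if "x \<in> G b" for x
  proof -
    obtain p where p: "x = (\<Sum>v \<in> S. scale (p v) v)"
      using S(2) unfolding span_finite[OF S(1)] by blast
    have v: "hcomp b (scale (p v) v) = (\<Sum>c | hcomp c v \<noteq> 0. scale (hpart (b - c) (p v)) (hcomp c v))" for v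
    proof -
      have "scale (p v) v = scale (p v) (\<Sum>c | hcomp c v \<noteq> 0. hcomp c v)"
        by (rule arg_cong[OF sum_hcomp])
      also have "\<dots> = (\<Sum>c | hcomp c v \<noteq> 0. scale (p v) (hcomp c v))"
        by (rule scale_sum_right)
      finally have "hcomp b (scale (p v) v) = hcomp b (\<Sum>c | hcomp c v \<noteq> 0. scale (p v) (hcomp c v))"
        by (rule arg_cong)
      also have "\<dots> = (\<Sum>c | hcomp c v \<noteq> 0. hcomp b (scale (p v) (hcomp c v)))"
        by (rule hcomp_sum)
      also have "\<dots> = (\<Sum>c | hcomp c v \<noteq> 0. scale (hpart (b - c) (p v)) (hcomp c v))"
        by (intro sum.cong refl hcomp_scale hcomp_in_grade)
      finally show ?thesis .
    qed
    have x: "hcomp b x = (\<Sum>v \<in> S. \<Sum>c | hcomp c v \<noteq> 0. scale (hpart (b - c) (p v)) (hcomp c v))"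
      unfolding p hcomp_sum by (intro sum.cong refl v)
    have "scale (hpart (b - c) (p v)) (hcomp c v) \<in> kvs.span T" if "v \<in> S" "hcomp c v \<noteq> 0" for v c
      using hpart_homogeneous[of "b - c" "p v"]
    proof (rule homogeneous_polys_cases)
      fix t k assume t: "tdeg t = b - c" "hpart (b - c) (p v) = Poly_Mapping.single t k"
      have "scale (Poly_Mapping.single t 1) (hcomp c v) \<in> kvs.span T"
        using that t(1) by (intro kvs.span_base) (auto simp: T_def)
      from kvs.span_scale[OF this, of k] show ?thesis
        by (simp add: t(2) const_def mult_single)
    qed (simp add: kvs.span_zero)
    then have "hcomp b x \<in> kvs.span T"
      unfolding x by (intro kvs.span_sum) auto
    then show ?thesis
      using hcomp_grade[OF that, of b] by simp
  qed
  ultimately show thesis using that by blast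
qed

text \<open>
  A degree \<open>a\<close> lies in \<open>s + \<nat>\<^sup>Z\<close> with \<open>Z = {j. s\<^sub>j = g\<^sub>j}\<close> only if \<open>s = min a g\<close>, so bases of the
  degree parts in the box give a decomposition.
\<close>

lemma ex_determined_stanley:
  assumes fg: "finitely_generated scale" and pd: "positively_determined scale G g"
  shows "\<exists>D. determined_hilbert_decomposition scale G g D \<and> induced_by_stanley scale G D"
proof -
  \<comment> \<open>A K-basis of M_b, finite because M_b lies in the span of a finite set.\<close>
  have "\<exists>B. B \<subseteq> G b \<and> kvs.independent B \<and> G b \<subseteq> kvs.span B \<and> finite B" for b
  proof -
    obtain T where T: "finite T" "G b \<subseteq> kvs.span T"
      using finite_spanning_grade[OF fg] .
    obtain B where B: "B \<subseteq> G b" "kvs.independent B" "G b \<subseteq> kvs.span B"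
      using kvs.basis_exists .
    have "finite B"
      using kvs.independent_span_bound[OF T(1) B(2)] B(1) T(2) by simp
    with B show ?thesis by blast
  qed
  then obtain B where B: "\<And>b. B b \<subseteq> G b" "\<And>b. kvs.independent (B b)"
    "\<And>b. G b \<subseteq> kvs.span (B b)" "\<And>b. finite (B b)"
    by metis
  \<comment> \<open>An index is a basis vector together with its degree, so \<open>fst\<close> and
    \<open>snd\<close> serve as the families of degrees and generators. \<open>Z\<close> takes the
    smallest sets of variables that g-determinedness permits.\<close>
  define I where "I = (SIGMA s : degree_box g. B s)"
  define Z where "Z i = {j. fst i j = int (g j)}" for i :: "'n mdeg \<times> 'm"
  have finite_I: "finite I"
    unfolding I_def by (intro finite_SigmaI finite_degree_box B)
  have box_I: "fst i \<in> degree_box g" and m: "snd i \<in> G (fst i)" if "i \<in> I" for i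
    using that B(1)[of "fst i"] by (auto simp: I_def)
  have "bij_betw (ev I snd) (fam_grade I Z fst b) (G b)" if b: "b \<in> degree_box g" for b
  proof -
    \<comment> \<open>In degree \<open>b\<close> of the box, the exponent b - s can be positive only
      at j with s_j = g_j \<ge> b_j, which is impossible. Thus only constants at the generators of
      degree \<open>b\<close> itself remain, and evaluation becomes linear combination of
      \<open>B b\<close>.\<close>
    have concentrated: "\<exists>c. f i = (if fst i = b then const c else 0)"
      if f: "f \<in> fam_grade I Z fst b" for f :: "'n mdeg \<times> 'm \<Rightarrow> ('n, 'k) mpolys" and i
    proof (cases "i \<in> I")
      case True
      then have "f i \<in> homogeneous_polys (b - fst i)" "f i \<in> polys_in (Z i)"
        using f by (auto simp: fam_grade_def polys_fam_def)
      then show ?thesis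
      proof (elim homogeneous_polys_cases)
        assume "f i = 0"
        then show ?thesis by (intro exI[of _ 0]) (simp add: const_def)
      next
        fix t c assume t: "tdeg t = b - fst i" "c \<noteq> 0" "f i = Poly_Mapping.single t c" "f i \<in> polys_in (Z i)"
        have "Poly_Mapping.lookup t j = 0" for j
        proof (rule ccontr)
          assume nz: "Poly_Mapping.lookup t j \<noteq> 0"
          then have "j \<in> Z i"
            using t by (auto simp: polys_in_def in_keys_iff subset_iff)
          then have "fst i j = int (g j)"
            by (simp add: Z_def)
          moreover have "b j \<le> int (g j)"
            using b by (simp add: degree_box_def)
          ultimately show False
            using nz fun_cong[OF t(1), of j] by (simp add: tdeg_def)
        qed
        then have "t = 0"
          by (intro poly_mapping_eqI) simp
        moreover from this t(1) have "fst i = b"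
          by (simp add: tdeg_zero)
        ultimately show ?thesis
          using t(3) by (intro exI[of _ c]) (simp add: const_def)
      qed
    next
      case False
      then show ?thesis
        using fam_grade_outside[OF f] by (intro exI[of _ 0]) (simp add: const_def)
    qed
    have coeffs: "\<exists>c. (\<forall>i. f i = (if fst i = b then const (c (snd i)) else 0)) \<and>
        ev I snd f = (\<Sum>v \<in> B b. scale (const (c v)) v)"
      if f: "f \<in> fam_grade I Z fst b" for f :: "'n mdeg \<times> 'm \<Rightarrow> ('n, 'k) mpolys"
    proof -
      obtain c where c: "\<And>i. f i = (if fst i = b then const (c i) else 0)"
        using concentrated[OF f] by metis
      have "ev I snd f = (\<Sum>i \<in> Pair b ` B b. scale (f i) (snd i))"
        unfolding ev_def using finite_I b c
        by (intro sum.mono_neutral_right) (auto simp: I_def)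
      also have "\<dots> = (\<Sum>v \<in> B b. scale (const (c (b, v))) v)"
        by (subst sum.reindex) (auto simp: inj_on_def c)
      finally show ?thesis
        using c by (intro exI[of _ "\<lambda>v. c (b, v)"]) auto
    qed
    show ?thesis
    proof (rule bij_betw_imageI)
      show "inj_on (ev I snd) (fam_grade I Z fst b)"
      proof (rule inj_onI)
        fix f h :: "'n mdeg \<times> 'm \<Rightarrow> ('n, 'k) mpolys"
        assume f: "f \<in> fam_grade I Z fst b" and h: "h \<in> fam_grade I Z fst b"
          and eq: "ev I snd f = ev I snd h"
        obtain c where c: "\<forall>i. f i = (if fst i = b then const (c (snd i)) else 0)"
          "ev I snd f = (\<Sum>v \<in> B b. scale (const (c v)) v)"
          using coeffs[OF f] by blast
        obtain d where d: "\<forall>i. h i = (if fst i = b then const (d (snd i)) else 0)"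
          "ev I snd h = (\<Sum>v \<in> B b. scale (const (d v)) v)"
          using coeffs[OF h] by blast
        have "(\<Sum>v \<in> B b. scale (const (c v - d v)) v) = 0"
          using eq unfolding c(2) d(2) by (simp add: kvs.scale_left_diff_distrib sum_subtractf)
        then have cd: "c v - d v = 0" if "v \<in> B b" for v
          by (rule kvs.independentD[OF B(2) B(4) subset_refl _ that])
        show "f = h"
        proof
          fix i
          consider "i \<notin> I" | "fst i \<noteq> b" | "fst i = b" "snd i \<in> B b"
            by (cases i) (auto simp: I_def)
          then show "f i = h i"
          proof cases
            case 1
            then show ?thesis
              using fam_grade_outside[OF f] fam_grade_outside[OF h] by simp
          qed (use spec[OF c(1), of i] spec[OF d(1), of i] cd[of "snd i"] in auto)
        qed
      qed
      show "ev I snd ` fam_grade I Z fst b = G b"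
      proof (intro equalityI subsetI)
        fix x assume "x \<in> G b"
        then obtain c where c: "x = (\<Sum>v \<in> B b. scale (const (c v)) v)"
          using B(3)[of b] unfolding kvs.span_finite[OF B(4)] by auto
        let ?f = "\<lambda>i. if i \<in> I \<and> fst i = b then const (c (snd i)) else 0"
        have "ev I snd ?f = (\<Sum>i \<in> Pair b ` B b. scale (?f i) (snd i))"
          unfolding ev_def using finite_I b
          by (intro sum.mono_neutral_right) (auto simp: I_def)
        also have "\<dots> = x"
          unfolding c using b by (subst sum.reindex) (auto simp: inj_on_def I_def intro!: sum.cong)
        finally have "x = ev I snd ?f" by (rule sym)
        moreover have "?f \<in> fam_grade I Z fst b"
          using const_in_homogeneous_polys
          by (auto simp: fam_grade_def polys_fam_def const_in_polys_in)
        ultimately show "x \<in> ev I snd ` fam_grade I Z fst b"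
          by (rule image_eqI)
      next
        fix x assume "x \<in> ev I snd ` fam_grade I Z fst b"
        then show "x \<in> G b"
          using ev_in_grade[of I snd fst _ Z b, OF m] by blast
      qed
    qed
  qed
  then have bij: "bij_betw (ev I snd) (polys_fam I Z) UNIV"
    using box_I m by (intro bij_betw_ev_of_degree_box[OF pd box_I]) (auto simp: Z_def)
  obtain D where "determined_hilbert_decomposition scale G g D" "induced_by_stanley scale G D"
    by (rule ex_determined_decomposition[OF finite_I m bij box_I]) (assumption | rule that)+
  then show ?thesis by blast
qed

text \<open>Entries come from a finite set: finitely many sets of variables, and degrees in the box.
  The length is bounded because the generators of degree \<open>b\<close> correspond to independent
  vectors of M_b, at most \<open>card (T b)\<close> many. So even the lists, not just their
  multisets, are finite in number.\<close>

lemma finite_determined_hilbert_decompositions: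
  assumes fg: "finitely_generated scale" and pd: "positively_determined scale G g"
  shows "finite {D. determined_hilbert_decomposition scale G g D}"
proof -
  have "\<exists>T. finite T \<and> G b \<subseteq> kvs.span T" for b
  proof -
    obtain T where "finite T" "G b \<subseteq> kvs.span T"
      using finite_spanning_grade[OF fg] .
    then show ?thesis by blast
  qed
  then obtain T where T: "\<And>b. finite (T b)" "\<And>b. G b \<subseteq> kvs.span (T b)"
    by metis
  let ?A = "range (polys_in :: 'n set \<Rightarrow> ('n, 'k) mpolys set) \<times> degree_box g"
  let ?N = "\<Sum>b \<in> degree_box g. card (T b)"
  let ?scale = "\<lambda>(c :: 'k) (f :: nat \<Rightarrow> ('n, 'k) mpolys) i. const c * f i"
  have "set D \<subseteq> ?A \<and> length D \<le> ?N" if D: "determined_hilbert_decomposition scale G g D" for D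
  proof -
    have algebras: "\<forall>(A, s) \<in> set D. \<exists>Z. A = polys_in Z"
      and bounded: "\<forall>(A, s) \<in> set D. s \<le> (\<lambda>k. int (g k))"
      using D by (auto simp: determined_hilbert_decomposition_def hilbert_decomposition_def)
    obtain \<phi> where lin: "Vector_Spaces.linear (\<lambda>c. scale (const c)) ?scale \<phi>"
      and bij: "bij_betw \<phi> UNIV (shifted_sum D)"
      and grade: "\<And>a. \<phi> ` G a = shifted_sum_grade D a"
      using D by (auto simp: determined_hilbert_decomposition_def hilbert_decomposition_def)
    interpret \<phi>: Vector_Spaces.linear "\<lambda>c. scale (const c)" ?scale \<phi>
      by (rule lin)
    \<comment> \<open>The generator of the \<open>i\<close>-th summand: 1 at position
      \<open>i\<close>, homogeneous of degree \<open>snd (D ! i)\<close>.\<close>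
    define e where "e i = (\<lambda>k. if k = i then 1 else 0 :: ('n, 'k) mpolys)" for i :: nat
    have inj_e: "inj e"
      by (rule injI) (metis e_def zero_neq_one)
    have e_grade: "e i \<in> shifted_sum_grade D (snd (D ! i))" if i: "i < length D" for i
    proof -
      obtain Z where "fst (D ! i) = polys_in Z"
        using algebras nth_mem[OF i] by (auto simp: case_prod_beta)
      then show ?thesis
        using i
        by (auto simp: shifted_sum_grade_def shifted_sum_def e_def one_in_polys_in
          one_in_homogeneous_polys) (use algebras nth_mem in \<open>fastforce simp: case_prod_beta\<close>)
    qed
    have in_box: "snd (D ! i) \<in> degree_box g" if i: "i < length D" for i
    proof -
      \<comment> \<open>The preimage of the nonzero \<open>e i\<close> shows that M is nonzero in
        this degree, which gives the lower bound of the box.\<close>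
      obtain x where x: "x \<in> G (snd (D ! i))" "\<phi> x = e i"
        using e_grade[OF i] unfolding grade[symmetric] by (metis imageE)
      have "e i \<noteq> 0"
        by (metis e_def zero_fun_apply zero_neq_one)
      then have "x \<noteq> 0"
        using x(2) \<phi>.zero by metis
      then have "\<forall>k. 0 \<le> snd (D ! i) k"
        using x(1) pd unfolding positively_determined_def by blast
      then show ?thesis
        using bounded nth_mem[OF i] by (auto simp: degree_box_def le_fun_def case_prod_beta)
    qed
    \<comment> \<open>The unit families of degree \<open>b\<close> are independent, and they lie in
      the image of M_b, which the image of \<open>T b\<close> spans.\<close>
    have card: "card {i \<in> {..<length D}. snd (D ! i) = b} \<le> card (T b)" for b
    proof -
      let ?J = "{i \<in> {..<length D}. snd (D ! i) = b}"
      have "\<phi>.vs2.independent (e ` ?J)"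
      proof
        assume "\<phi>.vs2.dependent (e ` ?J)"
        then obtain u i where i: "i \<in> ?J" "u (e i) \<noteq> 0" and u: "(\<Sum>v \<in> e ` ?J. ?scale (u v) v) = 0"
          by (subst (asm) \<phi>.vs2.dependent_finite) auto
        have "(\<Sum>v \<in> e ` ?J. ?scale (u v) v) i = (\<Sum>k \<in> ?J. const (u (e k)) * e k i)"
          unfolding sum_fun_apply
          by (subst sum.reindex) (use inj_e in \<open>auto intro: inj_on_subset\<close>)
        also have "\<dots> = (\<Sum>k \<in> ?J. if k = i then const (u (e i)) else 0)"
          by (intro sum.cong) (auto simp: e_def)
        also have "\<dots> = const (u (e i))"
          using i(1) by simp
        finally have "const (u (e i)) = (0 :: ('n, 'k) mpolys)"
          unfolding u by simp
        then show False
          using i(2) by (metis const_def lookup_single_eq lookup_zero)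
      qed
      moreover have "e ` ?J \<subseteq> \<phi>.vs2.span (\<phi> ` T b)"
        unfolding \<phi>.span_image using e_grade grade T(2)[of b] by blast
      ultimately have "card (e ` ?J) \<le> card (\<phi> ` T b)"
        using \<phi>.vs2.independent_span_bound[of "\<phi> ` T b" "e ` ?J"] T(1) by simp
      also have "\<dots> \<le> card (T b)"
        by (rule card_image_le[OF T(1)])
      finally show ?thesis
        using card_image[OF inj_on_subset[OF inj_e subset_UNIV], of ?J] by simp
    qed
    have "(\<lambda>i. snd (D ! i)) ` {..<length D} \<subseteq> degree_box g"
      using in_box by blast
    then have "length D = (\<Sum>b \<in> degree_box g. card {i \<in> {..<length D}. snd (D ! i) = b})"
      using sum.group[of "{..<length D}" "degree_box g" "\<lambda>i. snd (D ! i)" "\<lambda>_. 1 :: nat"]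
      by (simp add: finite_degree_box)
    also have "\<dots> \<le> ?N"
      by (rule sum_mono) (rule card)
    finally have "length D \<le> ?N" .
    moreover have "set D \<subseteq> ?A"
    proof
      fix x assume x: "x \<in> set D"
      then obtain i where "i < length D" "x = D ! i"
        by (metis in_set_conv_nth)
      then show "x \<in> ?A"
        using bspec[OF algebras x] in_box[of i] by (auto simp: mem_Times_iff case_prod_beta)
    qed
    ultimately show ?thesis by blast
  qed
  then have "{D. determined_hilbert_decomposition scale G g D} \<subseteq> {D. set D \<subseteq> ?A \<and> length D \<le> ?N}"
    by blast
  moreover have "finite {D. set D \<subseteq> ?A \<and> length D \<le> ?N}"
    by (intro finite_lists_length_le finite_cartesian_product finite_degree_box) simp
  ultimately show ?thesis
    by (rule finite_subset)
qed

end

section \<open>Comparison of depths and Stanley depth as a maximum\<close>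

lemma decomposition_depth_algebras:
  "decomposition_depth D = (INF A \<in> fst ` set D. krull_dim (subring_of A))"
  by (simp add: decomposition_depth_def image_image case_prod_beta)

text \<open>Depth sees only the subalgebras, which an induced decomposition shares with the Stanley
  decomposition inducing it.\<close>

lemma decomposition_depth_induced:
  assumes "list_all2 (\<lambda>(A, s) (B, m). A = B \<and> P s m) D E"
  shows "decomposition_depth D = decomposition_depth E"
proof -
  have "map fst D = map fst E"
    using assms by (induction rule: list_all2_induct) auto
  then have "fst ` set D = fst ` set E"
    by (metis set_map)
  then show ?thesis
    by (simp only: decomposition_depth_algebras)
qed

theorem mainTheorem4:
  fixes scale :: "('n::finite, 'k::field) mpolys \<Rightarrow> 'm::ab_group_add \<Rightarrow> 'm"
    and G :: "'n mdeg \<Rightarrow> 'm set"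
    and g :: "'n \<Rightarrow> nat"
  assumes "multigraded_module scale G"
    and "finitely_generated scale"
    and "positively_determined scale G g"
  defines "depths \<equiv> {decomposition_depth D | D.
      determined_hilbert_decomposition scale G g D \<and> induced_by_stanley scale G D}"
  shows "finite (mset ` {D. determined_hilbert_decomposition scale G g D}) \<and>
    finite depths \<and> depths \<noteq> {} \<and> sdepth scale G = Max depths"
proof -
  interpret multigraded_module scale G by fact
  have finite_D: "finite {D. determined_hilbert_decomposition scale G g D}"
    by (rule finite_determined_hilbert_decompositions) fact+
  have "depths \<subseteq> decomposition_depth ` {D. determined_hilbert_decomposition scale G g D}"
    unfolding depths_def by blast
  then have finite: "finite depths"
    by (rule finite_subset) (intro finite_imageI finite_D)
  have nonempty: "depths \<noteq> {}"
    using ex_determined_stanley[OF assms(2,3)] unfolding depths_def by blast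
  have "sdepth scale G = Max depths"
  proof (rule antisym)
    \<comment> \<open>Every Stanley decomposition is dominated by an induced g-determined
      one.\<close>
    have "decomposition_depth E \<le> Max depths" if E: "stanley_decomposition scale G E" for E
    proof -
      obtain D where D: "determined_hilbert_decomposition scale G g D" "induced_by_stanley scale G D"
        "decomposition_depth E \<le> decomposition_depth D"
        using stanley_decomposition_improve[OF assms(3) E] .
      then have "decomposition_depth D \<in> depths"
        unfolding depths_def by blast
      then show ?thesis
        using D(3) Max_ge[OF finite] by (metis order_trans)
    qed
    then show "sdepth scale G \<le> Max depths"
      unfolding sdepth_def by (intro Sup_least) auto
    \<comment> \<open>The maximum is attained, and the Stanley decomposition inducing this
      \<open>D\<close> has the same depth.\<close>
    obtain D where D: "Max depths = decomposition_depth D" "induced_by_stanley scale G D"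
      using Max_in[OF finite nonempty] unfolding depths_def by blast
    then obtain E where "stanley_decomposition scale G E"
        "list_all2 (\<lambda>(A, s) (B, m). A = B \<and> m \<in> G s) D E"
      unfolding induced_by_stanley_def by blast
    then show "Max depths \<le> sdepth scale G"
      unfolding D(1) sdepth_def
      by (intro Sup_upper) (auto dest: decomposition_depth_induced[where P = "\<lambda>s m. m \<in> G s"])
  qed
  with finite_D finite nonempty show ?thesis by simp
qed

end
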